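(* Consider the edge-averaging process on the cycle with $n$ vertices, with i.i.d.\ initial opinions uniformly distributed on $\{-1,1\}$, and let $\varepsilon\in(0,1/3)$. Then there is $n_\varepsilon$ such that for all $n>n_\varepsilon$, $$\mathbb{E}[\tau_\varepsilon]\ge c\,\frac{\log^2(n)}{\varepsilon^4},$$ where $c>0$ is a universal constant.
   Context: Edge-averaging process: each vertex $v\in V$ carries an opinion $f_t(v)\in\mathbb R$ at each time $t\ge 0$. Each edge carries an independent rate-one Poisson clock (independent of the initial opinions). When the clock of edge $\{u,v\}$ rings at time $t$, both endpoints update to $f_t(u)=f_t(v)=\frac{f_{t-}(u)+f_{t-}(v)}{2}$, where $f_{t-}(u)=\lim_{s\uparrow t}f_s(u)$; other opinions are unchanged. $\mathrm{osc}(f):=\sup_{u,v}|f(u)-f(v)|$ and $\tau_\varepsilon:=\min\{t\ge0:\mathrm{osc}(f_t)\le\varepsilon\}$. *)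

theory Defs
  imports "HOL-Probability.Probability"
begin

text \<open>Cycle with n vertices 0..n-1; edge i joins i and (i+1) mod n.
 Averaging along edge i:\<close>
definition cyc_avg :: "nat \<Rightarrow> (nat \<Rightarrow> real) \<Rightarrow> nat \<Rightarrow> (nat \<Rightarrow> real)" where
  "cyc_avg n f i = (let j = Suc i mod n; m = (f i + f j) / 2 in f(i := m, j := m))"

text \<open>X (i,j) is the j-th inter-arrival time of the Poisson clock of edge i;
 ring_time X i k is the time of its k-th ring (counting from 0).\<close>
definition ring_time :: "(nat \<times> nat \<Rightarrow> real) \<Rightarrow> nat \<Rightarrow> nat \<Rightarrow> real" where
  "ring_time X i k = (\<Sum>j\<le>k. X (i, j))"

definition ring_times_upto :: "nat \<Rightarrow> (nat \<times> nat \<Rightarrow> real) \<Rightarrow> real \<Rightarrow> real set" where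
  "ring_times_upto n X t = {ring_time X i k | i k. i < n \<and> ring_time X i k \<le> t}"

definition edges_ringing_at :: "nat \<Rightarrow> (nat \<times> nat \<Rightarrow> real) \<Rightarrow> real \<Rightarrow> nat list" where
  "edges_ringing_at n X s = sorted_list_of_set {i. i < n \<and> (\<exists>k. ring_time X i k = s)}"

text \<open>Opinions at time t: apply all rings up to time t in chronological order
 (simultaneous rings / infinitely many rings are null events; they are handled
 by an arbitrary convention).\<close>
definition opinion :: "nat \<Rightarrow> (nat \<Rightarrow> real) \<Rightarrow> (nat \<times> nat \<Rightarrow> real) \<Rightarrow> real \<Rightarrow> (nat \<Rightarrow> real)" where
  "opinion n f0 X t =
     (if finite (ring_times_upto n X t)
      then fold (\<lambda>s f. fold (\<lambda>i g. cyc_avg n g i) (edges_ringing_at n X s) f)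
             (sorted_list_of_set (ring_times_upto n X t)) f0
      else f0)"

definition osc :: "nat \<Rightarrow> (nat \<Rightarrow> real) \<Rightarrow> real" where
  "osc n f = Max {\<bar>f u - f v\<bar> | u v. u < n \<and> v < n}"

text \<open>tau_eps (infinite if osc never drops to eps).\<close>
definition tau :: "nat \<Rightarrow> real \<Rightarrow> (nat \<Rightarrow> real) \<Rightarrow> (nat \<times> nat \<Rightarrow> real) \<Rightarrow> ennreal" where
  "tau n \<epsilon> f0 X = Inf {ennreal t | t. t \<ge> 0 \<and> osc n (opinion n f0 X t) \<le> \<epsilon>}"

definition edge_avg_space :: "nat \<Rightarrow> ((nat \<Rightarrow> real) \<times> (nat \<times> nat \<Rightarrow> real)) measure" where
  "edge_avg_space n =
     PiM {..<n} (\<lambda>_. measure_pmf (pmf_of_set {-1, 1::real}))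
     \<Otimes>\<^sub>M PiM ({..<n} \<times> UNIV) (\<lambda>_. density lborel (exponential_density 1))"

end

theory Submission
  imports Defs "HOL-Real_Asymp.Real_Asymp"
begin

text \<open>
  The oscillation never increases, so it suffices to find a time \<open>T\<close> of order
  \<open>(log n)\<^sup>2 / \<epsilon>\<^sup>4\<close> at which it still exceeds \<open>\<epsilon>\<close> with probability bounded below. The
  memoryless property shows that the sequence of ringing edges is i.i.d. uniform and that no more
  than about \<open>4 n T\<close> rings occur before \<open>T\<close>. For a fixed sequence of rings the opinion at \<open>v\<close> is a
  weighted average of the initial opinions, and averaging over the sequence, the second moment of
  these weights grows by at most \<open>1/n\<close> per ring. So for most of many disjoint blocks the weights
  of the centre put mass \<open>3/4\<close> within distance of order \<open>\<surd>T\<close> and all but \<open>\<epsilon>/8\<close> inside the block.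
  Tilting the \<open>O(\<surd>T)\<close> nearby spins to mean \<open>2 \<epsilon>\<close> shows that the centre of such a block has opinion
  about \<open>\<epsilon>\<close> (or about \<open>-\<epsilon>\<close>) with probability at least of order \<open>\<epsilon>\<^sup>2 exp (- C \<epsilon>\<^sup>2 \<surd>T)\<close>, a small
  negative power of \<open>n\<close>, and there are of order \<open>\<surd>n\<close> independent blocks, so both signs occur.
\<close>

subsection \<open>Evolution along a sequence of rings\<close>

definition evolve :: "nat \<Rightarrow> nat list \<Rightarrow> (nat \<Rightarrow> real) \<Rightarrow> nat \<Rightarrow> real" where
  "evolve n xs f = fold (\<lambda>i g. cyc_avg n g i) xs f"

text \<open>Averaging is linear, so this is the coefficient of the initial opinion of
  \<open>u\<close> in the opinion of \<open>v\<close> once the edges \<open>xs\<close> have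
  rung.\<close>

definition weight :: "nat \<Rightarrow> nat list \<Rightarrow> nat \<Rightarrow> nat \<Rightarrow> real" where
  "weight n xs v u = evolve n xs (indicator {u}) v"

lemma cyc_avg_apply:
  "cyc_avg n f i v = (if v = i \<or> v = Suc i mod n then (f i + f (Suc i mod n)) / 2 else f v)"
  by (auto simp: cyc_avg_def Let_def)

lemma evolve_Nil [simp]: "evolve n [] f = f"
  and evolve_Cons: "evolve n (i # xs) f = evolve n xs (cyc_avg n f i)"
  and evolve_snoc: "evolve n (xs @ [i]) f = cyc_avg n (evolve n xs f) i"
  by (auto simp: evolve_def)

lemma evolve_eq_sum_weight:
  assumes "set xs \<subseteq> {..<n}" "v < n"
  shows "evolve n xs f v = (\<Sum>u<n. weight n xs v u * f u)"
  using assms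
proof (induction xs arbitrary: v rule: rev_induct)
  case Nil
  have "(\<Sum>u<n. indicator {u} v * f u) = (\<Sum>u<n. if u = v then f u else 0)"
    by (intro sum.cong) (auto simp: indicator_def)
  then show ?case using Nil by (simp add: weight_def)
next
  case (snoc i xs)
  then have i: "i < n" "Suc i mod n < n" by auto
  have IH: "evolve n xs f w = (\<Sum>u<n. weight n xs w u * f u)" if "w < n" for w
    using snoc that by auto
  show ?case
    using snoc.prems i
    by (auto simp: evolve_snoc weight_def cyc_avg_apply IH[unfolded weight_def]
        sum.distrib[symmetric] sum_divide_distrib algebra_simps add_divide_distrib)
qed

lemma weight_nonneg: "0 \<le> weight n xs v u"
proof (induction xs arbitrary: v rule: rev_induct)
  case (snoc i xs)
  then show ?case by (auto simp: weight_def evolve_snoc cyc_avg_apply)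
qed (auto simp: weight_def)

lemma evolve_const: "evolve n xs (\<lambda>_. c) = (\<lambda>_. c)"
  by (induction xs rule: rev_induct) (auto simp: evolve_snoc cyc_avg_apply)

text \<open>Constants are fixed by every averaging, so expanding the constant 1 in the weights gives
  their total.\<close>

lemma sum_weight:
  assumes "set xs \<subseteq> {..<n}" "v < n"
  shows "(\<Sum>u<n. weight n xs v u) = 1"
  using evolve_eq_sum_weight[OF assms, of "\<lambda>_. 1"] by (simp add: evolve_const)

section \<open>Monotonicity of the oscillation\<close>

lemma finite_osc_set: "finite {\<bar>f u - f v\<bar> | u v. u < n \<and> v < (n::nat)}"
proof -
  have "{\<bar>f u - f v\<bar> | u v. u < n \<and> v < n} = (\<lambda>(u,v). \<bar>f u - f v\<bar>) ` ({..<n} \<times> {..<n})"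
    by auto
  then show ?thesis by simp
qed

lemma osc_ge: "u < n \<Longrightarrow> v < n \<Longrightarrow> \<bar>f u - f v\<bar> \<le> osc n f"
  unfolding osc_def by (rule Max_ge[OF finite_osc_set]) auto

lemma osc_le:
  assumes "0 < n" "\<And>u v. u < n \<Longrightarrow> v < n \<Longrightarrow> \<bar>f u - f v\<bar> \<le> c"
  shows "osc n f \<le> c"
  unfolding osc_def using assms by (subst Max_le_iff[OF finite_osc_set]) auto

lemma osc_cyc_avg_le:
  assumes "i < n"
  shows "osc n (cyc_avg n f i) \<le> osc n f"
proof (rule osc_le)
  show "0 < n" using assms by simp
  fix u v assume uv: "u < n" "v < n"
  let ?j = "Suc i mod n"
  have "?j < n" using assms by simp
  note * = osc_ge[of _ n _ f]
  show "\<bar>cyc_avg n f i u - cyc_avg n f i v\<bar> \<le> osc n f"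
    using *[OF uv] *[OF uv(1) assms] *[OF uv(1) \<open>?j < n\<close>] *[OF uv(2) assms] *[OF uv(2) \<open>?j < n\<close>]
    by (simp add: cyc_avg_apply abs_le_iff) (auto simp: field_simps)
qed

lemma osc_evolve_le: "set xs \<subseteq> {..<n} \<Longrightarrow> osc n (evolve n xs f) \<le> osc n f"
proof (induction xs arbitrary: f)
  case (Cons i xs)
  then show ?case using osc_cyc_avg_le[of i n f] by (fastforce simp: evolve_Cons intro: order_trans)
qed auto

text \<open>While the rings of \<open>xs\<close> are in progress only a prefix has acted, and the
  remaining rings can only lower the oscillation. A lower bound after all of \<open>xs\<close>
  therefore holds at every earlier stage.\<close>

lemma osc_evolve_take_ge:
  assumes "set xs \<subseteq> {..<n}"
  shows "osc n (evolve n xs f) \<le> osc n (evolve n (take m xs) f)"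
proof -
  have "evolve n xs f = evolve n (drop m xs) (evolve n (take m xs) f)"
    unfolding evolve_def by (metis append_take_drop_id fold_append comp_apply)
  then show ?thesis
    using osc_evolve_le[of "drop m xs" n] assms set_drop_subset[of m xs] by (metis order_trans)
qed

section \<open>Second moment of the weights, averaged over ring sequences\<close>

text \<open>Only the two edges at \<open>u\<close> change the value there, each by half the
  increment towards a neighbour. Summed over \<open>i\<close>, the change is half the discrete
  Laplacian of \<open>\<phi>\<close> at \<open>u\<close>, hence at most 1.\<close>

lemma sum_cyc_avg_le:
  assumes "2 \<le> n" "u < n"
    and \<phi>: "\<phi> (Suc u mod n) + \<phi> ((u + n - 1) mod n) \<le> 2 * \<phi> u + 2"
  shows "(\<Sum>i<n. cyc_avg n \<phi> i u) \<le> n * \<phi> u + 1"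
proof -
  let ?p = "(u + n - 1) mod n"
  have p: "?p < n" using assms by simp
  have ne: "?p \<noteq> u"
    using assms by (cases "u = 0") (auto simp: mod_if)
  have eq: "u = Suc i mod n \<longleftrightarrow> i = ?p" if "i < n" for i
    using that assms by (cases "u = 0"; cases "Suc i = n") (auto simp: mod_if)
  have "(\<Sum>i<n. cyc_avg n \<phi> i u - \<phi> u)
      = (\<Sum>i<n. (if i = u then (\<phi> (Suc u mod n) - \<phi> u) / 2 else 0)
             + (if i = ?p then (\<phi> ?p - \<phi> u) / 2 else 0))"
  proof (rule sum.cong)
    fix i assume "i \<in> {..<n}"
    then have i: "i < n" by simp
    show "cyc_avg n \<phi> i u - \<phi> u = (if i = u then (\<phi> (Suc u mod n) - \<phi> u) / 2 else 0)
             + (if i = ?p then (\<phi> ?p - \<phi> u) / 2 else 0)"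
      using ne eq[OF i] by (auto simp: cyc_avg_apply field_simps)
  qed simp
  also have "\<dots> = (\<phi> (Suc u mod n) - \<phi> u) / 2 + (\<phi> ?p - \<phi> u) / 2"
    using p assms by (simp add: sum.distrib)
  also have "\<dots> \<le> 1" using \<phi> by (simp add: field_simps)
  finally show ?thesis by (simp add: sum_subtractf)
qed

lemma sum_lists_Suc:
  fixes h :: "'a list \<Rightarrow> real"
  shows "(\<Sum>xs | set xs \<subseteq> A \<and> length xs = Suc N. h xs)
     = (\<Sum>xs | set xs \<subseteq> A \<and> length xs = N. \<Sum>i\<in>A. h (i # xs))"
proof -
  have "(\<Sum>xs | set xs \<subseteq> A \<and> length xs = Suc N. h xs)
      = (\<Sum>(xs, i)\<in>{xs. set xs \<subseteq> A \<and> length xs = N} \<times> A. h (i # xs))"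
    by (subst lists_length_Suc_eq, subst sum.reindex)
       (auto simp: inj_on_def case_prod_beta')
  then show ?thesis by (simp add: sum.cartesian_product)
qed

text \<open>Divided by \<open>n ^ N\<close> this is an expectation over i.i.d. uniform rings.
  Peeling off the first ring keeps the weights of the remaining sequence fixed while
  \<open>\<phi>\<close> is averaged along a uniform edge; this raises each value by at most
  \<open>1 / n\<close> in the mean, and the weights sum to 1.\<close>

lemma sum_evolve_le:
  assumes "2 \<le> n" "v < n"
    and \<phi>: "\<And>u. u < n \<Longrightarrow> \<phi> (Suc u mod n) + \<phi> ((u + n - 1) mod n) \<le> 2 * \<phi> u + 2"
  shows "(\<Sum>xs | set xs \<subseteq> {..<n} \<and> length xs = N. evolve n xs \<phi> v) \<le> n ^ N * (\<phi> v + N / n)"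
proof (induction N)
  case 0
  have "{xs. set xs \<subseteq> {..<n} \<and> length xs = 0} = {[]}" by auto
  then show ?case by simp
next
  case (Suc N)
  let ?L = "{xs. set xs \<subseteq> {..<n} \<and> length xs = N}"
  have step: "(\<Sum>i<n. evolve n (i # xs) \<phi> v) \<le> n * evolve n xs \<phi> v + 1" if "xs \<in> ?L" for xs
  proof -
    have xs: "set xs \<subseteq> {..<n}" using that by auto
    have "(\<Sum>i<n. evolve n (i # xs) \<phi> v) = (\<Sum>i<n. \<Sum>u<n. weight n xs v u * cyc_avg n \<phi> i u)"
      using evolve_eq_sum_weight[OF xs assms(2)] by (simp add: evolve_Cons)
    also have "\<dots> = (\<Sum>u<n. weight n xs v u * (\<Sum>i<n. cyc_avg n \<phi> i u))"
      by (subst sum.swap) (simp add: sum_distrib_left)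
    also have "\<dots> \<le> (\<Sum>u<n. weight n xs v u * (n * \<phi> u + 1))"
      using assms by (intro sum_mono mult_left_mono sum_cyc_avg_le weight_nonneg) auto
    also have "\<dots> = n * (\<Sum>u<n. weight n xs v u * \<phi> u) + (\<Sum>u<n. weight n xs v u)"
      by (simp add: sum_distrib_left sum.distrib algebra_simps)
    finally show ?thesis
      using sum_weight[OF xs assms(2)] evolve_eq_sum_weight[OF xs assms(2)] by simp
  qed
  have fin: "card ?L = n ^ N" using card_lists_length_eq[of "{..<n}" N] by simp
  have "(\<Sum>xs | set xs \<subseteq> {..<n} \<and> length xs = Suc N. evolve n xs \<phi> v)
     \<le> (\<Sum>xs\<in>?L. n * evolve n xs \<phi> v + 1)"
    unfolding sum_lists_Suc by (rule sum_mono) (use step in auto)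
  also have "\<dots> = n * (\<Sum>xs\<in>?L. evolve n xs \<phi> v) + n ^ N"
    using fin by (simp add: sum.distrib sum_distrib_left)
  also have "\<dots> \<le> n * (n ^ N * (\<phi> v + N / n)) + n ^ N"
    using Suc by (intro add_right_mono mult_left_mono) auto
  also have "\<dots> = n ^ Suc N * (\<phi> v + Suc N / n)"
    using assms(1) by (simp add: field_simps)
  finally show ?case by simp
qed

text \<open>The cap at \<open>R\<close> hides the seam of the cycle between \<open>n - 1\<close> and \<open>0\<close>, so
  \<open>min (d\<^sup>2) (R\<^sup>2)\<close> has discrete Laplacian at most 2 everywhere on the cycle.\<close>

definition capsq :: "nat \<Rightarrow> nat \<Rightarrow> nat \<Rightarrow> real" where
  "capsq R v u = min ((real u - real v)\<^sup>2) ((real R)\<^sup>2)"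

text \<open>At distance at least \<open>R\<close> from \<open>v\<close> the function is at its
  maximum. Closer in, \<open>R \<le> v\<close> and \<open>v + R < n\<close> keep \<open>u\<close>
  off the seam, so its neighbours are \<open>u - 1\<close> and \<open>u + 1\<close>, and the second
  difference of a square is 2.\<close>

lemma capsq_laplacian_le:
  assumes "2 \<le> n" "u < n" "R \<le> v" "v + R < n"
  shows "capsq R v (Suc u mod n) + capsq R v ((u + n - 1) mod n) \<le> 2 * capsq R v u + 2"
proof -
  have le: "capsq R v w \<le> (real w - real v)\<^sup>2" "capsq R v w \<le> (real R)\<^sup>2" for w
    by (auto simp: capsq_def)
  have far: "capsq R v w = (real R)\<^sup>2" if "\<bar>real w - real v\<bar> \<ge> real R" for w
    using power_mono[OF that, of 2] by (simp add: capsq_def)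
  show ?thesis
  proof (cases "\<bar>real u - real v\<bar> \<ge> real R")
    case True
    then show ?thesis using far[of u] le(2)[of "Suc u mod n"] le(2)[of "(u + n - 1) mod n"] by simp
  next
    case False
    then have "0 < u" "Suc u < n" using assms by linarith+
    then have eqs: "Suc u mod n = Suc u" "(u + n - 1) mod n = u - 1"
      using assms(2) by (auto simp: mod_if)
    have "(real u - real v)\<^sup>2 \<le> (real R)\<^sup>2"
      using False power_mono[of "\<bar>real u - real v\<bar>" "real R" 2] by simp
    then have "capsq R v u = (real u - real v)\<^sup>2" by (simp add: capsq_def)
    moreover have "(real (Suc u) - real v)\<^sup>2 + (real (u - 1) - real v)\<^sup>2 = 2 * (real u - real v)\<^sup>2 + 2"
      using \<open>0 < u\<close> by (simp add: power2_eq_square algebra_simps of_nat_diff)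
    ultimately show ?thesis using le(1)[of "Suc u"] le(1)[of "u - 1"] eqs by simp
  qed
qed

text \<open>Chebyshev's inequality for the weights; \<open>r \<le> R\<close> ensures that the capped
  square is still at least \<open>r\<^sup>2\<close> outside radius \<open>r\<close>.\<close>

lemma outside_weight_le:
  assumes "set xs \<subseteq> {..<n}" "v < n" "r \<le> R"
  shows "real r ^ 2 * (\<Sum>u | u < n \<and> real r \<le> \<bar>real u - real v\<bar>. weight n xs v u)
     \<le> evolve n xs (capsq R v) v"
proof -
  have "real r ^ 2 * (\<Sum>u | u < n \<and> real r \<le> \<bar>real u - real v\<bar>. weight n xs v u)
      = (\<Sum>u | u < n \<and> real r \<le> \<bar>real u - real v\<bar>. weight n xs v u * real r ^ 2)"
    by (simp add: sum_distrib_left mult.commute)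
  also have "\<dots> \<le> (\<Sum>u | u < n \<and> real r \<le> \<bar>real u - real v\<bar>. weight n xs v u * capsq R v u)"
  proof (intro sum_mono mult_left_mono weight_nonneg)
    fix u assume "u \<in> {u. u < n \<and> real r \<le> \<bar>real u - real v\<bar>}"
    then have "real r ^ 2 \<le> (real u - real v) ^ 2"
      using power_mono[of "real r" "\<bar>real u - real v\<bar>" 2] by simp
    moreover have "real r ^ 2 \<le> real R ^ 2" using assms by (intro power_mono) auto
    ultimately show "real r ^ 2 \<le> capsq R v u" by (simp add: capsq_def)
  qed
  also have "\<dots> \<le> (\<Sum>u<n. weight n xs v u * capsq R v u)"
    by (intro sum_mono2 mult_nonneg_nonneg weight_nonneg) (auto simp: capsq_def)
  finally show ?thesis using evolve_eq_sum_weight[OF assms(1,2)] by simp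
qed

subsection \<open>The order of the rings\<close>

text \<open>The inter-arrival times seen just after edge \<open>i\<close> has rung first:
  \<open>i\<close> drops its first waiting time, the other edges keep their residual ones. The
  restriction to the index set makes the result a point of the product space.\<close>

definition shift_clock :: "nat \<Rightarrow> nat \<Rightarrow> (nat \<times> nat \<Rightarrow> real) \<Rightarrow> (nat \<times> nat \<Rightarrow> real)" where
  "shift_clock n i X = (\<lambda>(k, j) \<in> {..<n} \<times> UNIV.
     if k = i then X (k, Suc j) else if j = 0 then X (k, 0) - X (i, 0) else X (k, j))"

definition rings_first :: "nat \<Rightarrow> nat \<Rightarrow> (nat \<times> nat \<Rightarrow> real) \<Rightarrow> bool" where
  "rings_first n i X \<longleftrightarrow> (\<forall>k<n. k \<noteq> i \<longrightarrow> X (i, 0) < X (k, 0))"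

fun ring_order :: "nat \<Rightarrow> nat list \<Rightarrow> (nat \<times> nat \<Rightarrow> real) \<Rightarrow> bool" where
  "ring_order n [] X = True"
| "ring_order n (i # xs) X = (rings_first n i X \<and> ring_order n xs (shift_clock n i X))"

text \<open>For nonempty \<open>xs\<close>, on \<open>ring_order n xs X\<close>, this is the time of
  the last ring of \<open>xs\<close>, added up from the waiting times of the successively restarted
  clocks.\<close>

fun ring_duration :: "nat \<Rightarrow> nat list \<Rightarrow> (nat \<times> nat \<Rightarrow> real) \<Rightarrow> real" where
  "ring_duration n [] X = 0"
| "ring_duration n (i # xs) X = X (i, 0) + ring_duration n xs (shift_clock n i X)"

text \<open>The strict inequality in \<open>rings_first\<close> allows only one first edge. This
  makes the events belonging to different sequences disjoint.\<close>

lemma ring_order_unique: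
  assumes "ring_order n xs X" "ring_order n ys X" "length xs = length ys"
    "set xs \<subseteq> {..<n}" "set ys \<subseteq> {..<n}"
  shows "xs = ys"
  using assms
proof (induction xs arbitrary: ys X)
  case (Cons i xs)
  then obtain j zs where ys: "ys = j # zs" by (cases ys) auto
  have "i = j"
    using Cons.prems ys by (auto simp: rings_first_def) (metis less_asym)
  then show ?case using Cons ys by auto
qed auto

lemma sorted_list_of_set_insert_shift:
  fixes A :: "real set"
  assumes "finite A" "\<And>r. r \<in> A \<Longrightarrow> 0 < r"
  shows "sorted_list_of_set (insert s ((+) s ` A)) = s # map ((+) s) (sorted_list_of_set A)"
    (is "_ = ?xs")
proof -
  have "sorted ?xs" using assms by (auto simp: sorted_map order_less_imp_le)
  moreover have "distinct ?xs" using assms by (auto simp: distinct_map intro: inj_onI) (metis less_irrefl)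
  moreover have "set ?xs = insert s ((+) s ` A)" using assms by simp
  ultimately show ?thesis by (metis sorted_list_of_set.idem_if_sorted_distinct)
qed

section \<open>Restarting the clocks at the first ring\<close>

context
  fixes n i :: nat and X :: "nat \<times> nat \<Rightarrow> real"
  assumes i: "i < n"
    and pos: "\<forall>k<n. \<forall>j. 0 < X (k, j)"
    and first: "rings_first n i X"
begin

lemma shift_clock_pos: "k < n \<Longrightarrow> 0 < shift_clock n i X (k, j)"
  using pos first by (auto simp: shift_clock_def rings_first_def)

lemma ring_time_shift_same: "ring_time X i (Suc k) = X (i, 0) + ring_time (shift_clock n i X) i k"
  using i by (simp add: ring_time_def sum.atMost_Suc_shift shift_clock_def del: sum.atMost_Suc)

lemma ring_time_shift_other:
  "k' < n \<Longrightarrow> k' \<noteq> i \<Longrightarrow> ring_time X k' k = X (i, 0) + ring_time (shift_clock n i X) k' k"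
  by (induction k) (auto simp: ring_time_def shift_clock_def)

lemma ring_time_shift_pos: "k' < n \<Longrightarrow> 0 < ring_time (shift_clock n i X) k' k"
  unfolding ring_time_def by (intro sum_pos shift_clock_pos) auto

lemma ring_time_0: "ring_time X i 0 = X (i, 0)"
  by (simp add: ring_time_def)

text \<open>The rings of an edge are those of its restarted clock delayed by
  \<open>X (i, 0)\<close>, together with the ring at \<open>X (i, 0)\<close> itself if the edge is
  \<open>i\<close>. The free predicate \<open>P\<close> serves both the set of ring times and the
  edges ringing at a given time.\<close>

lemma ring_time_iff:
  assumes "k' < n"
  shows "(\<exists>k. P (ring_time X k' k)) \<longleftrightarrow>
    (k' = i \<and> P (X (i, 0))) \<or> (\<exists>k. P (X (i, 0) + ring_time (shift_clock n i X) k' k))"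
proof (cases "k' = i")
  case True
  have "(\<exists>k. P (ring_time X i k)) \<longleftrightarrow> P (ring_time X i 0) \<or> (\<exists>k. P (ring_time X i (Suc k)))"
    by (metis not0_implies_Suc)
  then show ?thesis using True by (simp add: ring_time_0 ring_time_shift_same)
next
  case False
  then show ?thesis using assms by (simp add: ring_time_shift_other)
qed

lemma ring_times_upto_before: "t < X (i, 0) \<Longrightarrow> ring_times_upto n X t = {}"
proof -
  assume t: "t < X (i, 0)"
  have "\<not> (\<exists>k. ring_time X k' k \<le> t)" if "k' < n" for k'
    using t ring_time_shift_pos[OF that] by (subst ring_time_iff[OF that]) (auto simp: not_le intro: less_trans add_pos_pos)
  then show ?thesis by (auto simp: ring_times_upto_def)
qed

lemma ring_times_upto_after:
  assumes "X (i, 0) \<le> t"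
  shows "ring_times_upto n X t
    = insert (X (i, 0)) ((+) (X (i, 0)) ` ring_times_upto n (shift_clock n i X) (t - X (i, 0)))"
proof (rule set_eqI)
  fix x
  have "x \<in> ring_times_upto n X t \<longleftrightarrow> (\<exists>k'<n. \<exists>k. x = ring_time X k' k \<and> ring_time X k' k \<le> t)"
    by (auto simp: ring_times_upto_def)
  also have "\<dots> \<longleftrightarrow> (\<exists>k'<n. (k' = i \<and> x = X (i,0) \<and> X (i,0) \<le> t) \<or>
      (\<exists>k. x = X (i, 0) + ring_time (shift_clock n i X) k' k \<and> X (i, 0) + ring_time (shift_clock n i X) k' k \<le> t))"
    by (intro ex_cong conj_cong refl ring_time_iff[where P = "\<lambda>y. x = y \<and> y \<le> t"])
  also have "\<dots> \<longleftrightarrow> x \<in> insert (X (i, 0)) ((+) (X (i, 0)) ` ring_times_upto n (shift_clock n i X) (t - X (i, 0)))"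
    (is "?l \<longleftrightarrow> ?r")
  proof
    assume ?l
    then show ?r by (fastforce simp: ring_times_upto_def image_iff le_diff_eq add.commute)
  next
    assume ?r
    then consider "x = X (i, 0)" | k' k where "k' < n" "x = X (i, 0) + ring_time (shift_clock n i X) k' k"
        "ring_time (shift_clock n i X) k' k \<le> t - X (i, 0)"
      by (auto simp: ring_times_upto_def)
    then show ?l
    proof cases
      case 1
      then show ?thesis using i assms by blast
    next
      case 2
      then show ?thesis by (metis le_diff_eq add.commute)
    qed
  qed
  finally show "x \<in> ring_times_upto n X t \<longleftrightarrow> x \<in> insert (X (i, 0)) ((+) (X (i, 0)) ` ring_times_upto n (shift_clock n i X) (t - X (i, 0)))" .
qed

lemma edges_ringing_at_first: "edges_ringing_at n X (X (i, 0)) = [i]"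
proof -
  have "(\<exists>k. ring_time X k' k = X (i, 0)) \<longleftrightarrow> k' = i" if "k' < n" for k'
    using ring_time_shift_pos[OF that]
    by (subst ring_time_iff[OF that, where P = "\<lambda>y. y = X (i, 0)"]) (auto dest: less_imp_neq[symmetric])
  then have "{k'. k' < n \<and> (\<exists>k. ring_time X k' k = X (i, 0))} = {i}"
    using i by blast
  then show ?thesis by (simp add: edges_ringing_at_def)
qed

lemma edges_ringing_at_shift:
  "0 < r \<Longrightarrow> edges_ringing_at n X (X (i, 0) + r) = edges_ringing_at n (shift_clock n i X) r"
proof -
  assume "0 < r"
  then have "(\<exists>k. ring_time X k' k = X (i, 0) + r) \<longleftrightarrow> (\<exists>k. ring_time (shift_clock n i X) k' k = r)"
    if "k' < n" for k'
    by (subst ring_time_iff[OF that, where P = "\<lambda>y. y = X (i, 0) + r"]) auto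
  then have "{k'. k' < n \<and> (\<exists>k. ring_time X k' k = X (i, 0) + r)}
      = {k'. k' < n \<and> (\<exists>k. ring_time (shift_clock n i X) k' k = r)}"
    by blast
  then show ?thesis by (simp add: edges_ringing_at_def)
qed

text \<open>The chronological list starts with the ring of \<open>i\<close> and continues with the
  delayed rings of the restarted clocks. Finiteness is carried along because \<open>opinion\<close>
  falls back to the initial state when there are infinitely many ring times.\<close>

lemma opinion_shift:
  assumes t: "X (i, 0) \<le> t" and fin: "finite (ring_times_upto n (shift_clock n i X) (t - X (i, 0)))"
  shows "finite (ring_times_upto n X t)"
    and "opinion n f X t = opinion n (cyc_avg n f i) (shift_clock n i X) (t - X (i, 0))"
proof -
  let ?Y = "shift_clock n i X" and ?s = "X (i, 0)"
  let ?A = "ring_times_upto n ?Y (t - ?s)"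
  let ?h = "\<lambda>Z s f. fold (\<lambda>i g. cyc_avg n g i) (edges_ringing_at n Z s) f"
  have A: "0 < r" if "r \<in> ?A" for r
    using that ring_time_shift_pos by (auto simp: ring_times_upto_def)
  show fin': "finite (ring_times_upto n X t)"
    using fin by (simp add: ring_times_upto_after[OF t])
  have sorted: "sorted_list_of_set (ring_times_upto n X t) = ?s # map ((+) ?s) (sorted_list_of_set ?A)"
    unfolding ring_times_upto_after[OF t]
    by (rule sorted_list_of_set_insert_shift) (use fin A in auto)
  have "opinion n f X t = fold (?h X) (?s # map ((+) ?s) (sorted_list_of_set ?A)) f"
    using fin' by (simp add: opinion_def sorted)
  also have "\<dots> = fold (\<lambda>r. ?h X (?s + r)) (sorted_list_of_set ?A) (cyc_avg n f i)"
    by (simp add: edges_ringing_at_first fold_map comp_def)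
  also have "\<dots> = fold (?h ?Y) (sorted_list_of_set ?A) (cyc_avg n f i)"
    using fin A by (intro fold_cong) (auto simp: edges_ringing_at_shift)
  finally show "opinion n f X t = opinion n (cyc_avg n f i) ?Y (t - ?s)"
    using fin by (simp add: opinion_def)
qed

end

text \<open>Induction on \<open>xs\<close>, restarting at each ring: before \<open>X (i, 0)\<close>
  nothing has happened, and from then on \<open>opinion_shift\<close> passes to the restarted
  clocks. The bound on \<open>t\<close> excludes rings beyond \<open>xs\<close>.\<close>

lemma opinion_eq_evolve_take:
  assumes "\<forall>k<n. \<forall>j. 0 < X (k, j)" "ring_order n xs X" "set xs \<subseteq> {..<n}"
    "0 \<le> t" "t < ring_duration n xs X"
  shows "finite (ring_times_upto n X t) \<and> (\<exists>m. opinion n f X t = evolve n (take m xs) f)"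
  using assms
proof (induction xs arbitrary: X t f)
  case (Cons i xs)
  let ?Y = "shift_clock n i X"
  have *: "i < n" "rings_first n i X" "ring_order n xs ?Y" "set xs \<subseteq> {..<n}"
    using Cons.prems by auto
  note ctx = *(1) Cons.prems(1) *(2)
  show ?case
  proof (cases "t < X (i, 0)")
    case True
    then have "ring_times_upto n X t = {}" by (rule ring_times_upto_before[OF ctx])
    then have "opinion n f X t = evolve n (take 0 (i # xs)) f" by (simp add: opinion_def)
    with \<open>ring_times_upto n X t = {}\<close> show ?thesis by (metis finite.emptyI)
  next
    case False
    then have t: "X (i, 0) \<le> t" by simp
    have IH: "finite (ring_times_upto n ?Y (t - X (i, 0))) \<and>
       (\<exists>m. opinion n (cyc_avg n f i) ?Y (t - X (i, 0)) = evolve n (take m xs) (cyc_avg n f i))"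
      by (rule Cons.IH) (use * t Cons.prems(5) shift_clock_pos[OF ctx] in auto)
    then obtain m where "opinion n (cyc_avg n f i) ?Y (t - X (i, 0)) = evolve n (take m xs) (cyc_avg n f i)"
      by blast
    then have "opinion n f X t = evolve n (take (Suc m) (i # xs)) f"
      using IH opinion_shift(2)[OF ctx t] by (simp add: evolve_Cons)
    then show ?thesis using IH opinion_shift(1)[OF ctx t] by blast
  qed
qed auto

lemma osc_opinion_ge:
  assumes "\<forall>k<n. \<forall>j. 0 < X (k, j)" "ring_order n xs X" "set xs \<subseteq> {..<n}"
    "0 \<le> t" "t < ring_duration n xs X"
  shows "osc n (evolve n xs f) \<le> osc n (opinion n f X t)"
proof -
  obtain m where "opinion n f X t = evolve n (take m xs) f"
    using opinion_eq_evolve_take[OF assms] by blast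
  then show ?thesis using osc_evolve_take_ge[OF assms(3)] by simp
qed

subsection \<open>Memorylessness of the clocks\<close>

abbreviation exp_measure :: "real measure" where
  "exp_measure \<equiv> density lborel (exponential_density 1)"

definition clock_space :: "nat \<Rightarrow> (nat \<times> nat \<Rightarrow> real) measure" where
  "clock_space n = PiM ({..<n} \<times> UNIV) (\<lambda>_. exp_measure)"

lemma prob_space_exp_measure: "prob_space exp_measure"
  by (rule prob_space_exponential_density) simp

lemma prob_space_clock_space: "prob_space (clock_space n)"
  unfolding clock_space_def by (rule prob_space_PiM) (rule prob_space_exp_measure)

text \<open>Substituting \<open>x = s + y\<close> factors \<open>exp (- s)\<close> out of the
  density.\<close>

lemma exp_measure_memoryless:
  assumes s: "0 \<le> s" and A [measurable]: "A \<in> sets borel"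
  shows "emeasure exp_measure {x. s < x \<and> x - s \<in> A} = ennreal (exp (- s)) * emeasure exp_measure A"
proof -
  have m [measurable]: "{x. s < x \<and> x - s \<in> A} \<in> sets borel" by measurable
  have "emeasure exp_measure {x. s < x \<and> x - s \<in> A}
     = (\<integral>\<^sup>+x. ennreal (exponential_density 1 x) * indicator {x. s < x \<and> x - s \<in> A} x \<partial>lborel)"
    by (subst emeasure_density) auto
  also have "\<dots> = (\<integral>\<^sup>+y. ennreal (exponential_density 1 (s + y)) * indicator {x. s < x \<and> x - s \<in> A} (s + y) \<partial>lborel)"
    by (subst nn_integral_real_affine[where c = 1 and t = s]) auto
  also have "\<dots> = (\<integral>\<^sup>+y. ennreal (exp (- s)) * (ennreal (exponential_density 1 y) * indicator A y) \<partial>lborel)"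
  proof (rule nn_integral_cong_AE)
    \<comment> \<open>At \<open>y = 0\<close> the two sides can differ, since
      \<open>s < s + y\<close> fails there while the density is 1; this is a null set.\<close>
    show "AE y in lborel. ennreal (exponential_density 1 (s + y)) * indicator {x. s < x \<and> x - s \<in> A} (s + y)
       = ennreal (exp (- s)) * (ennreal (exponential_density 1 y) * indicator A y)"
      using AE_lborel_singleton[of 0]
    proof eventually_elim
      case (elim y)
      show ?case
      proof (cases "0 < y \<and> y \<in> A")
        case True
        then have "exponential_density 1 (s + y) = exp (- s) * exponential_density 1 y"
          using s by (simp add: exponential_density_def exp_add[symmetric])
        then show ?thesis using True by (simp add: ennreal_mult)
      next
        case False
        then have "y \<notin> A \<or> exponential_density 1 y = 0"
          using elim by (auto simp: exponential_density_def)
        then show ?thesis using False by auto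
      qed
    qed
  qed
  also have "\<dots> = ennreal (exp (- s)) * (\<integral>\<^sup>+y. ennreal (exponential_density 1 y) * indicator A y \<partial>lborel)"
    by (rule nn_integral_cmult) measurable
  also have "(\<integral>\<^sup>+y. ennreal (exponential_density 1 y) * indicator A y \<partial>lborel) = emeasure exp_measure A"
    by (subst emeasure_density) auto
  finally show ?thesis .
qed

text \<open>The weight \<open>exp (- a * s)\<close> turns the density of rate 1 into
  \<open>1 / (1 + a)\<close> times that of rate \<open>1 + a\<close>, whose total mass is 1.\<close>

lemma nn_integral_exp_measure_laplace:
  assumes "0 \<le> a"
  shows "(\<integral>\<^sup>+s. ennreal (exp (- a * s)) \<partial>exp_measure) = ennreal (1 / (1 + a))"
proof -
  interpret prob_space "density lborel (exponential_density (1 + a))"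
    by (rule prob_space_exponential_density) (use assms in simp)
  have "(\<integral>\<^sup>+s. ennreal (exp (- a * s)) \<partial>exp_measure)
      = (\<integral>\<^sup>+s. ennreal (exponential_density 1 s) * ennreal (exp (- a * s)) \<partial>lborel)"
    by (subst nn_integral_density) auto
  also have "\<dots> = (\<integral>\<^sup>+s. ennreal (1 / (1 + a)) * ennreal (exponential_density (1 + a) s) \<partial>lborel)"
  proof (rule nn_integral_cong)
    fix s :: real
    have "exponential_density 1 s * exp (- a * s) = 1 / (1 + a) * exponential_density (1 + a) s"
    proof -
      have "exp (- s) * exp (- (a * s)) = exp (- (s * (1 + a)))"
        by (simp add: exp_add[symmetric] algebra_simps)
      then show ?thesis using assms by (simp add: exponential_density_def)
    qed
    then show "ennreal (exponential_density 1 s) * ennreal (exp (- a * s))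
        = ennreal (1 / (1 + a)) * ennreal (exponential_density (1 + a) s)"
      using assms by (simp only: ennreal_mult'[symmetric] ennreal_mult[symmetric] exponential_density_nonneg
          zero_less_one exp_ge_zero divide_nonneg_nonneg zero_le_one add_nonneg_nonneg)
  qed
  also have "\<dots> = ennreal (1 / (1 + a)) * (\<integral>\<^sup>+s. ennreal (exponential_density (1 + a) s) \<partial>lborel)"
    by (rule nn_integral_cmult) measurable
  also have "(\<integral>\<^sup>+s. ennreal (exponential_density (1 + a) s) \<partial>lborel) = 1"
    using emeasure_space_1 by (simp add: emeasure_density)
  finally show ?thesis by simp
qed

lemma AE_exp_measure_pos: "AE x in exp_measure. 0 < x"
  using AE_lborel_singleton[of 0]
  by (subst AE_density) (auto simp: exponential_density_def elim!: eventually_mono)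

lemma AE_clock_space_pos: "AE X in clock_space n. \<forall>k<n. \<forall>j. 0 < X (k, j)"
proof -
  have "AE X in clock_space n. \<forall>q\<in>{..<n} \<times> UNIV. 0 < X q"
    unfolding clock_space_def
    by (intro AE_ball_countable' AE_PiM_component prob_space_exp_measure AE_exp_measure_pos) auto
  then show ?thesis by (rule eventually_mono) auto
qed

lemma clock_component_measurable:
  "k < n \<Longrightarrow> (\<lambda>X. X (k, j)) \<in> borel_measurable (clock_space n)"
proof -
  assume "k < n"
  then have "(\<lambda>X. X (k, j)) \<in> measurable (clock_space n) exp_measure"
    unfolding clock_space_def by (intro measurable_component_singleton) auto
  then show ?thesis by simp
qed

lemma shift_clock_measurable [measurable]:
  assumes [measurable]: "i < n"
  shows "shift_clock n i \<in> measurable (clock_space n) (clock_space n)"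
proof -
  note [measurable] = clock_component_measurable
  have "(\<lambda>X. \<lambda>q\<in>{..<n} \<times> UNIV. (case q of (k, j) \<Rightarrow>
      if k = i then X (k, Suc j) else if j = 0 then X (k, 0) - X (i, 0) else X (k, j)))
     \<in> measurable (clock_space n) (PiM ({..<n} \<times> UNIV) (\<lambda>_. exp_measure))"
  proof (rule measurable_restrict)
    fix q assume "q \<in> {..<n} \<times> (UNIV :: nat set)"
    then obtain k j where q: "q = (k, j)" and k [measurable]: "k < n" by auto
    have "(\<lambda>X. if k = i then X (k, Suc j) else if j = 0 then X (k, 0) - X (i, 0) else X (k, j))
      \<in> borel_measurable (clock_space n)"
      by measurable
    then show "(\<lambda>X. case q of (k, j) \<Rightarrow>
      if k = i then X (k, Suc j) else if j = 0 then X (k, 0) - X (i, 0) else X (k, j))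
      \<in> measurable (clock_space n) exp_measure"
      by (simp add: q)
  qed
  then show ?thesis by (simp add: shift_clock_def[abs_def] clock_space_def)
qed

lemma rings_first_measurable [measurable]:
  assumes [measurable]: "i < n"
  shows "Measurable.pred (clock_space n) (rings_first n i)"
proof -
  note [measurable] = clock_component_measurable
  have "Measurable.pred (clock_space n) (\<lambda>X. \<forall>k\<in>{..<n} - {i}. X (i, 0) < X (k, 0))"
    by (intro pred_intros_finite) auto
  then show ?thesis by (auto simp: rings_first_def[abs_def] Ball_def cong: measurable_cong)
qed

lemma prod_emb_PiE_eq_Collect:
  "prod_emb I M K (Pi\<^sub>E K C) = {Y \<in> space (PiM I M). \<forall>q\<in>K. Y q \<in> C q}"
  by (auto simp: prod_emb_iff space_PiM PiE_iff)

text \<open>Once \<open>s = X (i, 0)\<close> is fixed, the event constrains the other coordinates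
  separately: by memorylessness each of the \<open>n - 1\<close> other edges contributes a factor
  \<open>exp (- s)\<close>, and its residual time is again exponential. Integrating
  \<open>exp (- (a + n - 1) * s)\<close> over \<open>s\<close> gives
  \<open>1 / (n + a)\<close>.\<close>

lemma rings_first_rectangle_integral:
  assumes i: "i < n" and a: "0 \<le> a" and J: "finite J" "J \<subseteq> {..<n} \<times> UNIV"
    and A: "\<And>q. q \<in> J \<Longrightarrow> A q \<in> sets borel"
  shows "(\<integral>\<^sup>+X. indicator {X. rings_first n i X \<and> (\<forall>q\<in>J. shift_clock n i X q \<in> A q)} X
            * ennreal (exp (- a * X (i, 0))) \<partial>clock_space n)
       = ennreal (1 / (n + a)) * (\<Prod>q\<in>J. emeasure exp_measure (A q))"
proof -
  let ?I = "{..<n} \<times> (UNIV :: nat set)"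
  let ?I' = "?I - {(i, 0)}"
  let ?P = "PiM ?I' (\<lambda>_. exp_measure)"
  interpret E: prob_space exp_measure by (rule prob_space_exp_measure)
  interpret P: prob_space ?P by (intro prob_space_PiM prob_space_exp_measure)
  \<comment> \<open>\<open>Z\<close> collects the first waiting times of the other edges, which
    \<open>rings_first\<close> constrains whether or not they lie in \<open>J\<close>;
    \<open>B\<close> imposes no condition outside \<open>J\<close>.\<close>
  define Z where "Z = ({..<n} - {i}) \<times> {0::nat}"
  define B where "B q = (if q \<in> J then A q else UNIV)" for q
  have B [measurable]: "B q \<in> sets borel" for q using A by (auto simp: B_def)
  \<comment> \<open>\<open>\<rho> q\<close> is the coordinate of the original clocks that determines
    coordinate \<open>q\<close> of the shifted ones once \<open>X (i, 0)\<close> is known.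
    \<open>C s\<close> is the condition on it when \<open>X (i, 0) = s\<close>; the index
    \<open>j - 1\<close> undoes the shift on edge \<open>i\<close>.\<close>
  define \<rho> :: "nat \<times> nat \<Rightarrow> nat \<times> nat" where "\<rho> = (\<lambda>(k, j). if k = i then (k, Suc j) else (k, j))"
  have inj: "inj_on \<rho> S" for S by (auto simp: inj_on_def \<rho>_def split: if_splits)
  define C :: "real \<Rightarrow> nat \<times> nat \<Rightarrow> real set" where
    "C s = (\<lambda>(k, j). if k = i then B (i, j - 1) else if j = 0 then {x. s < x \<and> x - s \<in> B (k, 0)} else B (k, j))" for s
  have C [measurable]: "C s q \<in> sets borel" for s q
    by (cases q) (auto simp: C_def)
  have J2: "finite (J \<union> Z)" "J \<union> Z \<subseteq> ?I" "\<rho> ` (J \<union> Z) \<subseteq> ?I'"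
    using J by (auto simp: Z_def \<rho>_def split: if_splits)
  let ?G = "{X. rings_first n i X \<and> (\<forall>q\<in>J. shift_clock n i X q \<in> A q)}"
  let ?f = "\<lambda>X. indicator ?G X * ennreal (exp (- a * X (i, 0)))"
  have G_iff: "Y((i, 0) := s) \<in> ?G \<longleftrightarrow> (\<forall>q\<in>\<rho> ` (J \<union> Z). Y q \<in> C s q)" (is "?l \<longleftrightarrow> ?r") for Y s
  proof
    assume l: ?l
    show ?r
    proof
      fix q assume "q \<in> \<rho> ` (J \<union> Z)"
      then obtain k j where q: "q = \<rho> (k, j)" and "(k, j) \<in> J \<union> Z" by auto
      then have "k < n" "k = i \<Longrightarrow> (k, j) \<in> J" using J2 by (auto simp: Z_def)
      with l show "Y q \<in> C s q"
        unfolding q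
        by (auto simp: \<rho>_def C_def B_def rings_first_def shift_clock_def split: if_splits dest!: bspec[where x = "(k, j)"])
    qed
  next
    assume r: ?r
    have *: "Y (\<rho> q) \<in> C s (\<rho> q)" if "q \<in> J \<union> Z" for q using r that by blast
    have "rings_first n i (Y((i, 0) := s))"
      unfolding rings_first_def
    proof (intro allI impI)
      fix k assume "k < n" "k \<noteq> i"
      then show "(Y((i, 0) := s)) (i, 0) < (Y((i, 0) := s)) (k, 0)"
        using *[of "(k, 0)"] by (auto simp: Z_def \<rho>_def C_def)
    qed
    moreover have "shift_clock n i (Y((i, 0) := s)) q \<in> A q" if "q \<in> J" for q
      using *[of q] that J by (cases q) (auto simp: shift_clock_def \<rho>_def C_def B_def split: if_splits)
    ultimately show ?l by simp
  qed
  have ins: "insert (i, 0) ?I' = ?I" using i by auto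
  \<comment> \<open>The clocks are an independent \<open>X (i, 0)\<close> inserted into the
    remaining coordinates, so Fubini's theorem allows integrating over these first, with
    \<open>s\<close> fixed.\<close>
  have distr: "clock_space n = distr (exp_measure \<Otimes>\<^sub>M ?P) (clock_space n) (\<lambda>(x, X). X((i, 0) := x))"
    using distr_pair_PiM_eq_PiM[where I = ?I' and i' = "(i, 0)" and M = "\<lambda>_. exp_measure"]
      prob_space_exp_measure unfolding ins clock_space_def by simp
  have upd: "(\<lambda>(x, X). X((i, 0) := x)) \<in> measurable (exp_measure \<Otimes>\<^sub>M ?P) (clock_space n)"
  proof -
    have swap: "(\<lambda>p. (snd p, fst p)) \<in> measurable (exp_measure \<Otimes>\<^sub>M ?P) (?P \<Otimes>\<^sub>M exp_measure)"
      by (intro measurable_Pair measurable_snd measurable_fst)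
    have "(\<lambda>p. (\<lambda>(f, y). f((i, 0) := y)) (snd p, fst p))
        \<in> measurable (exp_measure \<Otimes>\<^sub>M ?P) (PiM (insert (i, 0) ?I') (\<lambda>_. exp_measure))"
      by (rule measurable_compose[OF swap measurable_add_dim])
    then show ?thesis unfolding ins clock_space_def by (simp add: case_prod_beta')
  qed
  have f [measurable]: "?f \<in> borel_measurable (clock_space n)"
  proof -
    have "Measurable.pred (clock_space n) (\<lambda>X. shift_clock n i X q \<in> A q)" if qJ: "q \<in> J" for q
    proof -
      obtain k j where q: "q = (k, j)" "k < n" using J qJ by auto
      have "(\<lambda>X. shift_clock n i X q) \<in> borel_measurable (clock_space n)"
        using measurable_compose[OF shift_clock_measurable[OF i] clock_component_measurable[OF q(2)]] q(1) by simp
      then show ?thesis using A[OF qJ] by (rule pred_sets2[rotated])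
    qed
    then have "Measurable.pred (clock_space n) (\<lambda>X. X \<in> ?G)"
      using i J by (auto intro!: pred_intros_logic pred_intros_finite rings_first_measurable)
    then have "{X \<in> space (clock_space n). X \<in> ?G} \<in> sets (clock_space n)" by (simp add: pred_def)
    then have "(indicator ?G :: _ \<Rightarrow> ennreal) \<in> borel_measurable (clock_space n)"
      unfolding indicator_def[abs_def] of_bool_def by (intro measurable_If) auto
    then show ?thesis using clock_component_measurable[OF i] by measurable
  qed
  have "(\<integral>\<^sup>+X. ?f X \<partial>clock_space n) = (\<integral>\<^sup>+sY. ?f ((\<lambda>(x, X). X((i, 0) := x)) sY) \<partial>(exp_measure \<Otimes>\<^sub>M ?P))"
    by (subst distr, subst nn_integral_distr) (use upd f in \<open>auto simp: distr[symmetric]\<close>)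
  also have "\<dots> = (\<integral>\<^sup>+s. \<integral>\<^sup>+Y. ?f (Y((i, 0) := s)) \<partial>?P \<partial>exp_measure)"
  proof (subst P.nn_integral_fst[symmetric])
    show "(\<lambda>sY. ?f ((\<lambda>(x, X). X((i, 0) := x)) sY)) \<in> borel_measurable (exp_measure \<Otimes>\<^sub>M ?P)"
      by (rule measurable_compose[OF upd f])
  qed simp
  also have "\<dots> = (\<integral>\<^sup>+s. ennreal (exp (- (a + real n - 1) * s)) * (\<Prod>q\<in>J. emeasure exp_measure (A q)) \<partial>exp_measure)"
  proof (rule nn_integral_cong_AE)
    show "AE s in exp_measure. (\<integral>\<^sup>+Y. ?f (Y((i, 0) := s)) \<partial>?P)
       = ennreal (exp (- (a + real n - 1) * s)) * (\<Prod>q\<in>J. emeasure exp_measure (A q))"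
      using AE_exp_measure_pos
    proof eventually_elim
      case (elim s)
      let ?S = "{Y \<in> space ?P. \<forall>q\<in>\<rho> ` (J \<union> Z). Y q \<in> C s q}"
      have "?S = prod_emb ?I' (\<lambda>_. exp_measure) (\<rho> ` (J \<union> Z)) (Pi\<^sub>E (\<rho> ` (J \<union> Z)) (C s))"
        by (rule prod_emb_PiE_eq_Collect[symmetric])
      then have S: "?S \<in> sets ?P" "emeasure ?P ?S = (\<Prod>q\<in>\<rho> ` (J \<union> Z). emeasure exp_measure (C s q))"
      proof -
        assume S: "?S = prod_emb ?I' (\<lambda>_. exp_measure) (\<rho> ` (J \<union> Z)) (Pi\<^sub>E (\<rho> ` (J \<union> Z)) (C s))"
        show "?S \<in> sets ?P" unfolding S using J2(1,3) by (intro sets_PiM_I) simp_all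
        show "emeasure ?P ?S = (\<Prod>q\<in>\<rho> ` (J \<union> Z). emeasure exp_measure (C s q))"
          unfolding S using J2(1,3) by (intro emeasure_PiM_emb prob_space_exp_measure) simp_all
      qed
      have "(\<integral>\<^sup>+Y. ?f (Y((i, 0) := s)) \<partial>?P) = (\<integral>\<^sup>+Y. ennreal (exp (- a * s)) * indicator ?S Y \<partial>?P)"
      proof (rule nn_integral_cong)
        fix Y assume "Y \<in> space ?P"
        then have "Y \<in> ?S \<longleftrightarrow> Y((i, 0) := s) \<in> ?G" using G_iff by blast
        then show "?f (Y((i, 0) := s)) = ennreal (exp (- a * s)) * indicator ?S Y"
          by (cases "Y \<in> ?S") (simp_all only: indicator_simps fun_upd_same simp_thms mult_zero_left mult_zero_right mult_1 mult_1_right)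
      qed
      also have "\<dots> = ennreal (exp (- a * s)) * emeasure ?P ?S"
        by (rule nn_integral_cmult_indicator[OF S(1)])
      also have "emeasure ?P ?S = (\<Prod>q\<in>J \<union> Z. emeasure exp_measure (C s (\<rho> q)))"
        unfolding S(2) by (subst prod.reindex[OF inj]) simp
      \<comment> \<open>The coordinates in \<open>Z\<close> pay \<open>exp (- s)\<close> for not
        having rung by time \<open>s\<close>; those of edge \<open>i\<close> and all later
        inter-arrival times keep their law.\<close>
      also have "\<dots> = (\<Prod>q\<in>J \<union> Z. (if q \<in> Z then ennreal (exp (- s)) else 1) * emeasure exp_measure (B q))"
      proof (rule prod.cong[OF refl])
        fix q assume q: "q \<in> J \<union> Z"
        obtain k j where kj: "q = (k, j)" by (cases q)
        have kn: "k < n" using q kj J2 by auto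
        show "emeasure exp_measure (C s (\<rho> q)) = (if q \<in> Z then ennreal (exp (- s)) else 1) * emeasure exp_measure (B q)"
          using exp_measure_memoryless[of s "B (k, 0)"] elim B kn
          by (auto simp: kj \<rho>_def C_def Z_def)
      qed
      also have "\<dots> = (\<Prod>q\<in>J \<union> Z. if q \<in> Z then ennreal (exp (- s)) else 1) * (\<Prod>q\<in>J \<union> Z. emeasure exp_measure (B q))"
        by (rule prod.distrib)
      also have "(\<Prod>q\<in>J \<union> Z. emeasure exp_measure (B q)) = (\<Prod>q\<in>J. emeasure exp_measure (A q))"
        using E.emeasure_space_1 J2(1) by (intro prod.mono_neutral_cong_right) (auto simp: B_def)
      also have "(\<Prod>q\<in>J \<union> Z. if q \<in> Z then ennreal (exp (- s)) else 1) = (\<Prod>q\<in>Z. ennreal (exp (- s)))"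
        using J2(1) by (intro prod.mono_neutral_cong_right) auto
      also have "\<dots> = ennreal (exp (- s)) ^ (n - 1)"
        using i by (simp add: Z_def card_cartesian_product)
      also have "\<dots> = ennreal (exp (- (real n - 1) * s))"
        using i by (simp add: ennreal_power exp_of_nat_mult[symmetric] of_nat_diff algebra_simps)
      also have "ennreal (exp (- a * s)) * (ennreal (exp (- (real n - 1) * s)) * (\<Prod>q\<in>J. emeasure exp_measure (A q)))
          = ennreal (exp (- (a + real n - 1) * s)) * (\<Prod>q\<in>J. emeasure exp_measure (A q))"
      proof -
        have "exp (- a * s) * exp (- (real n - 1) * s) = exp (- (a + real n - 1) * s)"
          by (simp add: exp_add[symmetric] algebra_simps)
        then have "ennreal (exp (- a * s)) * ennreal (exp (- (real n - 1) * s)) = ennreal (exp (- (a + real n - 1) * s))"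
          by (simp only: ennreal_mult[OF exp_ge_zero exp_ge_zero, symmetric])
        then show ?thesis by (simp only: mult.assoc[symmetric])
      qed
      finally show ?case .
    qed
  qed
  also have "\<dots> = (\<integral>\<^sup>+s. ennreal (exp (- (a + real n - 1) * s)) \<partial>exp_measure) * (\<Prod>q\<in>J. emeasure exp_measure (A q))"
    by (rule nn_integral_multc) measurable
  also have "(\<integral>\<^sup>+s. ennreal (exp (- (a + real n - 1) * s)) \<partial>exp_measure) = ennreal (1 / (n + a))"
    using nn_integral_exp_measure_laplace[of "a + n - 1"] a i by (simp add: add.commute)
  finally show ?thesis .
qed

text \<open>The clock law, weighted by the first-ring event and the exponential factor and pushed
  forward by \<open>shift_clock\<close>, agrees with \<open>1 / (n + a)\<close> times the clock law
  on finite-dimensional rectangles. These determine a finite measure on the product space, so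
  rectangles may be replaced by any \<open>F\<close>.\<close>

lemma clock_regeneration:
  assumes i: "i < n" and a: "0 \<le> a" and F [measurable]: "F \<in> borel_measurable (clock_space n)"
  shows "(\<integral>\<^sup>+X. indicator {X. rings_first n i X} X * ennreal (exp (- a * X (i, 0)))
            * F (shift_clock n i X) \<partial>clock_space n)
       = ennreal (1 / (n + a)) * (\<integral>\<^sup>+X. F X \<partial>clock_space n)"
proof -
  let ?C = "clock_space n" and ?I = "{..<n} \<times> (UNIV :: nat set)"
  interpret C: prob_space ?C by (rule prob_space_clock_space)
  let ?w = "\<lambda>X. indicator {X. rings_first n i X} X * ennreal (exp (- a * X (i, 0)))"
  have sh [measurable]: "shift_clock n i \<in> measurable ?C ?C" by (rule shift_clock_measurable[OF i])
  have "{X \<in> space ?C. rings_first n i X} \<in> sets ?C"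
    using rings_first_measurable[OF i] by (simp add: pred_def)
  then have "(indicator {X. rings_first n i X} :: _ \<Rightarrow> ennreal) \<in> borel_measurable ?C"
    unfolding indicator_def[abs_def] of_bool_def by (intro measurable_If) auto
  then have w [measurable]: "?w \<in> borel_measurable ?C"
    using clock_component_measurable[OF i] by measurable
  define \<mu> where "\<mu> = distr (density ?C ?w) ?C (shift_clock n i)"
  have "scale_measure (ennreal (1 / (n + a))) ?C = \<mu>"
  proof (rule measure_eqI_PiM_infinite[where I = ?I and M = "\<lambda>_. exp_measure"])
    show "sets (scale_measure (ennreal (1 / (n + a))) ?C) = sets (PiM ?I (\<lambda>_. exp_measure))"
      and "sets \<mu> = sets (PiM ?I (\<lambda>_. exp_measure))"
      by (simp_all add: \<mu>_def clock_space_def)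
    show "finite_measure (scale_measure (ennreal (1 / (n + a))) ?C)"
      by (rule finite_measureI) (simp add: space_scale_measure C.emeasure_space_1)
    fix A :: "nat \<times> nat \<Rightarrow> real set" and J :: "(nat \<times> nat) set"
    assume J: "finite J" "J \<subseteq> ?I" and A: "\<And>q. q \<in> J \<Longrightarrow> A q \<in> sets exp_measure"
    let ?R = "prod_emb ?I (\<lambda>_. exp_measure) J (Pi\<^sub>E J A)"
    have R_sets: "?R \<in> sets ?C"
      unfolding clock_space_def using J A by (intro sets_PiM_I) auto
    have R: "?R = {X \<in> space ?C. \<forall>q\<in>J. X q \<in> A q}"
      unfolding clock_space_def by (rule prod_emb_PiE_eq_Collect)
    have "emeasure \<mu> ?R = emeasure (density ?C ?w) (shift_clock n i -` ?R \<inter> space ?C)"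
      unfolding \<mu>_def by (subst emeasure_distr) (use R_sets in auto)
    also have "\<dots> = (\<integral>\<^sup>+X. ?w X * indicator (shift_clock n i -` ?R \<inter> space ?C) X \<partial>?C)"
      by (rule emeasure_density[OF w measurable_sets[OF sh R_sets]])
    also have "\<dots> = (\<integral>\<^sup>+X. indicator {X. rings_first n i X \<and> (\<forall>q\<in>J. shift_clock n i X q \<in> A q)} X
            * ennreal (exp (- a * X (i, 0))) \<partial>?C)"
      using measurable_space[OF sh] by (intro nn_integral_cong) (auto simp: R indicator_def)
    also have "\<dots> = ennreal (1 / (n + a)) * (\<Prod>q\<in>J. emeasure exp_measure (A q))"
      using J A by (intro rings_first_rectangle_integral i a) auto
    also have "(\<Prod>q\<in>J. emeasure exp_measure (A q)) = emeasure ?C ?R"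
      unfolding clock_space_def using J A
      by (intro emeasure_PiM_emb[symmetric] prob_space_exp_measure) auto
    finally show "emeasure (scale_measure (ennreal (1 / (n + a))) ?C) ?R = emeasure \<mu> ?R"
      by simp
  qed
  then have "ennreal (1 / (n + a)) * (\<integral>\<^sup>+X. F X \<partial>?C) = (\<integral>\<^sup>+X. F X \<partial>\<mu>)"
    using nn_integral_scale_measure[OF F] by metis
  also have "\<dots> = (\<integral>\<^sup>+X. F (shift_clock n i X) \<partial>density ?C ?w)"
    unfolding \<mu>_def by (rule nn_integral_distr) auto
  also have "\<dots> = (\<integral>\<^sup>+X. ?w X * F (shift_clock n i X) \<partial>?C)"
    by (rule nn_integral_density[OF w]) measurable
  finally show ?thesis by simp
qed

section \<open>Law of the ring order and of its duration\<close>

lemma ring_order_measurable: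
  "set xs \<subseteq> {..<n} \<Longrightarrow> Measurable.pred (clock_space n) (ring_order n xs)"
proof (induction xs)
  case Nil
  have "ring_order n [] = (\<lambda>X. True)" by (rule ext) simp
  then show ?case by simp
next
  case (Cons i xs)
  then have i: "i < n" by simp
  have "Measurable.pred (clock_space n) (\<lambda>X. ring_order n xs (shift_clock n i X))"
    using Cons by (intro measurable_compose[OF shift_clock_measurable[OF i]]) auto
  then show ?case using rings_first_measurable[OF i] by simp
qed

lemma ring_duration_measurable:
  "set xs \<subseteq> {..<n} \<Longrightarrow> ring_duration n xs \<in> borel_measurable (clock_space n)"
proof (induction xs)
  case Nil
  have "ring_duration n [] = (\<lambda>X. 0)" by (rule ext) simp
  then show ?case by simp
next
  case (Cons i xs)
  then have i: "i < n" by simp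
  have "(\<lambda>X. ring_duration n xs (shift_clock n i X)) \<in> borel_measurable (clock_space n)"
    using Cons by (intro measurable_compose[OF shift_clock_measurable[OF i]]) auto
  then show ?case using clock_component_measurable[OF i] by simp
qed

lemma indicator_ring_order_measurable:
  assumes "set xs \<subseteq> {..<n}"
  shows "(indicator {X. ring_order n xs X} :: _ \<Rightarrow> ennreal) \<in> borel_measurable (clock_space n)"
proof -
  have "{X \<in> space (clock_space n). ring_order n xs X} \<in> sets (clock_space n)"
    using ring_order_measurable[OF assms] by (simp add: pred_def)
  then show ?thesis
    unfolding indicator_def[abs_def] of_bool_def by (intro measurable_If) auto
qed

text \<open>One application of \<open>clock_regeneration\<close> per ring. At \<open>a = 0\<close>
  it says that all sequences of the same length are equally likely; positive \<open>a\<close>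
  controls the duration.\<close>

lemma ring_order_laplace:
  assumes "set xs \<subseteq> {..<n}" and a: "0 \<le> a"
  shows "(\<integral>\<^sup>+X. indicator {X. ring_order n xs X} X * ennreal (exp (- a * ring_duration n xs X)) \<partial>clock_space n)
    = ennreal (1 / (n + a)) ^ length xs"
  using assms(1)
proof (induction xs)
  case Nil
  interpret prob_space "clock_space n" by (rule prob_space_clock_space)
  show ?case using emeasure_space_1 by simp
next
  case (Cons i xs)
  then have i: "i < n" and xs: "set xs \<subseteq> {..<n}" by auto
  let ?F = "\<lambda>X. indicator {X. ring_order n xs X} X * ennreal (exp (- a * ring_duration n xs X))"
  have F: "?F \<in> borel_measurable (clock_space n)"
    using indicator_ring_order_measurable[OF xs] ring_duration_measurable[OF xs] by measurable
  have "(\<integral>\<^sup>+X. indicator {X. ring_order n (i # xs) X} X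
        * ennreal (exp (- a * ring_duration n (i # xs) X)) \<partial>clock_space n)
     = (\<integral>\<^sup>+X. indicator {X. rings_first n i X} X * ennreal (exp (- a * X (i, 0)))
            * ?F (shift_clock n i X) \<partial>clock_space n)"
    by (intro nn_integral_cong)
       (auto simp: indicator_def ennreal_mult'[symmetric] exp_add[symmetric] ring_distribs)
  also have "\<dots> = ennreal (1 / (n + a)) * (\<integral>\<^sup>+X. ?F X \<partial>clock_space n)"
    by (rule clock_regeneration[OF i a F])
  finally show ?case using Cons.IH[OF xs] by simp
qed

text \<open>Chernoff's bound with parameter \<open>n\<close>, the total rate of the clocks.\<close>

lemma prob_ring_order_duration:
  assumes xs: "set xs \<subseteq> {..<n}" and n: "0 < n"
  shows "(1 / n) ^ length xs * (1 - exp (n * T) / 2 ^ length xs)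
    \<le> measure (clock_space n) {X \<in> space (clock_space n). ring_order n xs X \<and> T < ring_duration n xs X}"
    (is "_ \<le> measure ?C ?E")
proof -
  interpret prob_space ?C by (rule prob_space_clock_space)
  note [measurable] = ring_order_measurable[OF xs] ring_duration_measurable[OF xs]
    indicator_ring_order_measurable[OF xs]
  have E [measurable]: "?E \<in> sets ?C" by measurable
  let ?N = "length xs"
  let ?g = "\<lambda>X. indicator {X. ring_order n xs X} X * ennreal (exp (- real n * ring_duration n xs X))"
  have "ennreal ((1 / n) ^ ?N) = (\<integral>\<^sup>+X. indicator {X. ring_order n xs X} X \<partial>?C)"
    using ring_order_laplace[OF xs, of 0] by (simp add: ennreal_power)
  also have "\<dots> \<le> (\<integral>\<^sup>+X. indicator ?E X + ennreal (exp (n * T)) * ?g X \<partial>?C)"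
  proof (rule nn_integral_mono)
    fix X assume X: "X \<in> space ?C"
    show "indicator {X. ring_order n xs X} X \<le> indicator ?E X + ennreal (exp (n * T)) * ?g X"
    proof (cases "ring_order n xs X \<and> \<not> T < ring_duration n xs X")
      case True
      then have "1 \<le> exp (n * T) * exp (- real n * ring_duration n xs X)"
        by (simp add: exp_add[symmetric] mult_left_mono)
      then have "ennreal 1 \<le> ennreal (exp (n * T)) * ennreal (exp (- real n * ring_duration n xs X))"
        by (subst ennreal_mult[symmetric]) (auto intro: ennreal_leI simp del: ennreal_1)
      then show ?thesis using True by simp
    next
      case False
      then show ?thesis using X by (auto simp: indicator_def)
    qed
  qed
  also have "\<dots> = emeasure ?C ?E + ennreal (exp (n * T)) * (\<integral>\<^sup>+X. ?g X \<partial>?C)"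
    by (subst nn_integral_add) (auto simp: nn_integral_cmult)
  \<comment> \<open>At \<open>a = n\<close> each ring contributes \<open>1 / (2 * n)\<close>, half
    of its probability \<open>1 / n\<close>; this is the origin of the factor
    \<open>2 ^ length xs\<close>.\<close>
  also have "(\<integral>\<^sup>+X. ?g X \<partial>?C) = ennreal ((1 / (2 * n)) ^ ?N)"
    using ring_order_laplace[OF xs, of n] by (simp add: ennreal_power)
  also have "emeasure ?C ?E + ennreal (exp (n * T)) * ennreal ((1 / (2 * n)) ^ ?N)
     = ennreal (measure ?C ?E + exp (n * T) * (1 / (2 * n)) ^ ?N)"
    by (simp add: emeasure_eq_measure ennreal_plus ennreal_mult'[symmetric])
  finally have "(1 / n) ^ ?N \<le> measure ?C ?E + exp (n * T) * (1 / (2 * n)) ^ ?N"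
    by (subst (asm) ennreal_le_iff) auto
  moreover have "(1 / (2 * real n)) ^ ?N = (1 / n) ^ ?N / 2 ^ ?N"
    by (simp add: power_divide power_mult_distrib)
  ultimately show ?thesis by (simp add: right_diff_distrib mult.commute)
qed

subsection \<open>Tilted spins\<close>

abbreviation spin_pmf :: "real pmf" where
  "spin_pmf \<equiv> pmf_of_set {-1, 1}"

definition spin_space :: "nat \<Rightarrow> (nat \<Rightarrow> real) measure" where
  "spin_space n = PiM {..<n} (\<lambda>_. measure_pmf spin_pmf)"

lemma prob_space_spin_space: "prob_space (spin_space n)"
  unfolding spin_space_def by (rule prob_space_PiM) (rule measure_pmf.prob_space_axioms)

lemma AE_spin_space: "AE \<sigma> in spin_space n. \<forall>u<n. \<sigma> u = -1 \<or> \<sigma> u = 1"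
proof -
  have "AE x in measure_pmf spin_pmf. x = -1 \<or> x = 1"
    by (auto simp: AE_measure_pmf_iff)
  then have "AE \<sigma> in spin_space n. \<forall>u\<in>{..<n}. \<sigma> u = -1 \<or> \<sigma> u = 1"
    unfolding spin_space_def
    by (intro AE_ball_countable' AE_PiM_component measure_pmf.prob_space_axioms) auto
  then show ?thesis by (rule eventually_mono) auto
qed

lemma spin_component_measurable: "u < n \<Longrightarrow> (\<lambda>\<sigma>. \<sigma> u) \<in> borel_measurable (spin_space n)"
proof -
  assume "u < n"
  then have "(\<lambda>\<sigma>. \<sigma> u) \<in> measurable (spin_space n) (measure_pmf spin_pmf)"
    unfolding spin_space_def by (intro measurable_component_singleton) auto
  then have "(\<lambda>\<sigma>. id (\<sigma> u)) \<in> measurable (spin_space n) borel"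
    by (rule measurable_compose) simp
  then show ?thesis by simp
qed

lemma spin_sum_measurable:
  "D \<subseteq> {..<n} \<Longrightarrow> (\<lambda>\<sigma>. \<Sum>u\<in>D. w u * \<sigma> u) \<in> borel_measurable (spin_space n)"
  by (intro borel_measurable_sum borel_measurable_times spin_component_measurable) auto

lemma spin_prod_integrable: "integrable (spin_space n) (\<lambda>\<sigma>. \<Prod>u<n. g u (\<sigma> u) :: real)"
  and spin_prod_integral: "(\<integral>\<sigma>. (\<Prod>u<n. g u (\<sigma> u)) \<partial>spin_space n) = (\<Prod>u<n. (g u (-1) + g u 1) / 2)"
proof -
  interpret product_sigma_finite "\<lambda>_::nat. measure_pmf spin_pmf" by standard
  have int: "integrable (measure_pmf spin_pmf) (g u)" for u
    by (rule integrable_measure_pmf_finite) simp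
  show "integrable (spin_space n) (\<lambda>\<sigma>. \<Prod>u<n. g u (\<sigma> u))"
    unfolding spin_space_def by (rule product_integrable_prod) (auto intro: int)
  have "(\<integral>\<sigma>. (\<Prod>u<n. g u (\<sigma> u)) \<partial>spin_space n) = (\<Prod>u<n. integral\<^sup>L (measure_pmf spin_pmf) (g u))"
    unfolding spin_space_def by (rule product_integral_prod) (auto intro: int)
  also have "\<dots> = (\<Prod>u<n. (g u (-1) + g u 1) / 2)"
    by (intro prod.cong refl) (simp add: integral_pmf_of_set)
  finally show "(\<integral>\<sigma>. (\<Prod>u<n. g u (\<sigma> u)) \<partial>spin_space n) = (\<Prod>u<n. (g u (-1) + g u 1) / 2)" .
qed

text \<open>Tilting the spins in \<open>B\<close> to mean \<open>\<theta>\<close> has density \<open>Z = \<Prod>u\<in>B. 1 + \<theta> \<sigma> u\<close> with second moment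
  \<open>(1 + \<theta>\<^sup>2) ^ card B\<close>. The Cauchy--Schwarz inequality transfers the probability of the event from
  the tilted to the original measure.\<close>

lemma spin_tilt_lower_bound:
  fixes w :: "nat \<Rightarrow> real"
  assumes BD: "B \<subseteq> D" "D \<subseteq> {..<n}"
    and w: "(\<Sum>u\<in>D. \<bar>w u\<bar>) \<le> 1" and x: "0 \<le> x" and q: "0 < q" and \<theta>: "\<bar>\<theta>\<bar> \<le> 1"
    and mean: "q + x \<le> \<theta> * (\<Sum>u\<in>B. w u)"
  shows "q\<^sup>2 / (1 + \<theta>\<^sup>2) ^ card B
    \<le> measure (spin_space n) {\<sigma> \<in> space (spin_space n). x \<le> (\<Sum>u\<in>D. w u * \<sigma> u)}"
proof -
  interpret prob_space "spin_space n" by (rule prob_space_spin_space)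
  let ?M = "spin_space n"
  have finD: "finite D" using BD finite_subset by blast
  define z where "z u y = (if u \<in> B then 1 + \<theta> * y else (1::real))" for u y
  define Z where "Z \<sigma> = (\<Prod>u<n. z u (\<sigma> u))" for \<sigma> :: "nat \<Rightarrow> real"
  define S where "S \<sigma> = (\<Sum>u\<in>D. w u * \<sigma> u)" for \<sigma> :: "nat \<Rightarrow> real"
  define A where "A = {\<sigma> \<in> space ?M. x \<le> S \<sigma>}"
  have [measurable]: "S \<in> borel_measurable ?M"
    unfolding S_def by (rule spin_sum_measurable[OF BD(2)])
  have A [measurable]: "A \<in> sets ?M" unfolding A_def by measurable
  have Z_int: "integrable ?M Z"
    unfolding Z_def by (rule spin_prod_integrable)
  have "(z u (-1) + z u 1) / 2 = 1" for u by (simp add: z_def)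
  then have Z_mean: "integral\<^sup>L ?M Z = 1"
    unfolding Z_def spin_prod_integral by simp
  have Z2: "(Z \<sigma>)\<^sup>2 = (\<Prod>u<n. (z u (\<sigma> u))\<^sup>2)" for \<sigma>
    by (simp add: Z_def prod_power_distrib)
  have Z2_int: "integrable ?M (\<lambda>\<sigma>. (Z \<sigma>)\<^sup>2)"
    unfolding Z2 by (rule spin_prod_integrable)
  define m where "m = (1 + \<theta>\<^sup>2) ^ card B"
  have m: "0 < m" unfolding m_def by (intro zero_less_power add_pos_nonneg) auto
  have "(\<integral>\<sigma>. (Z \<sigma>)\<^sup>2 \<partial>?M) = (\<Prod>u<n. ((z u (-1))\<^sup>2 + (z u 1)\<^sup>2) / 2)"
    unfolding Z2 by (rule spin_prod_integral)
  also have "\<dots> = (\<Prod>u<n. if u \<in> B then 1 + \<theta>\<^sup>2 else 1)"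
    by (intro prod.cong refl) (auto simp: z_def power2_eq_square field_simps)
  also have "\<dots> = (\<Prod>u\<in>B. 1 + \<theta>\<^sup>2)"
    using BD by (subst prod.If_cases) (auto simp: Int_absorb2 Int_absorb1)
  finally have Z2_mean: "(\<integral>\<sigma>. (Z \<sigma>)\<^sup>2 \<partial>?M) = m" by (simp add: m_def)
  \<comment> \<open>Multiplying by \<open>\<sigma> u\<close> alters only the factor at
    \<open>u\<close>, so the product formula still applies; the tilted mean of a spin is
    \<open>\<theta>\<close> in \<open>B\<close> and 0 elsewhere.\<close>
  have Zs: "Z \<sigma> * \<sigma> u = (\<Prod>v<n. z v (\<sigma> v) * (if v = u then \<sigma> v else 1))" if "u < n" for u \<sigma>
    using that by (simp add: Z_def prod.distrib)
  have Zs_int: "integrable ?M (\<lambda>\<sigma>. Z \<sigma> * \<sigma> u)" if "u < n" for u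
    unfolding Zs[OF that] by (rule spin_prod_integrable[where g = "\<lambda>v y. z v y * (if v = u then y else 1)"])
  have Zs_mean: "(\<integral>\<sigma>. Z \<sigma> * \<sigma> u \<partial>?M) = (if u \<in> B then \<theta> else 0)" if "u < n" for u
  proof -
    have "(\<integral>\<sigma>. Z \<sigma> * \<sigma> u \<partial>?M) = (\<Prod>v<n. (z v (-1) * (if v = u then -1 else 1) + z v 1 * (if v = u then 1 else 1)) / 2)"
      unfolding Zs[OF that] by (rule spin_prod_integral[where g = "\<lambda>v y. z v y * (if v = u then y else 1)"])
    also have "\<dots> = (\<Prod>v<n. if v = u then (if u \<in> B then \<theta> else 0) else 1)"
      by (intro prod.cong refl) (auto simp: z_def)
    finally show ?thesis using that by simp
  qed
  have ZS: "Z \<sigma> * S \<sigma> = (\<Sum>u\<in>D. w u * (Z \<sigma> * \<sigma> u))" for \<sigma>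
    by (simp add: S_def sum_distrib_left mult_ac)
  have ZS_int: "integrable ?M (\<lambda>\<sigma>. Z \<sigma> * S \<sigma>)"
    unfolding ZS using BD by (intro Bochner_Integration.integrable_sum integrable_mult_right Zs_int) auto
  have "(\<integral>\<sigma>. Z \<sigma> * S \<sigma> \<partial>?M) = (\<Sum>u\<in>D. w u * (\<integral>\<sigma>. Z \<sigma> * \<sigma> u \<partial>?M))"
    unfolding ZS using BD by (subst Bochner_Integration.integral_sum) (auto intro!: integrable_mult_right Zs_int)
  also have "\<dots> = (\<Sum>u\<in>D. if u \<in> B then \<theta> * w u else 0)"
    using BD Zs_mean by (intro sum.cong refl) auto
  also have "\<dots> = \<theta> * (\<Sum>u\<in>B. w u)"
    using BD finD by (subst sum.If_cases) (auto simp: Int_absorb1 Int_absorb2 sum_distrib_left)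
  finally have ZS_mean: "(\<integral>\<sigma>. Z \<sigma> * S \<sigma> \<partial>?M) = \<theta> * (\<Sum>u\<in>B. w u)" .
  \<comment> \<open>Off \<open>A\<close> the sum is below \<open>x\<close>, and on \<open>A\<close>
    it is at most 1, so there \<open>Z\<close> itself is the bound. The Cauchy-Schwarz inequality
    enters in the linear form \<open>Z \<le> k / 2 * Z\<^sup>2 + 1 / (2 * k)\<close>; with
    \<open>k = q / m\<close> the quadratic term has mean exactly \<open>q / 2\<close>.\<close>
  define k where "k = q / m"
  have k: "0 < k" using q m by (simp add: k_def)
  have "(\<integral>\<sigma>. Z \<sigma> * S \<sigma> \<partial>?M) \<le> (\<integral>\<sigma>. x * Z \<sigma> + (k / 2 * (Z \<sigma>)\<^sup>2 + 1 / (2 * k) * indicator A \<sigma>) \<partial>?M)"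
  proof (rule integral_mono_AE)
    show "integrable ?M (\<lambda>\<sigma>. x * Z \<sigma> + (k / 2 * (Z \<sigma>)\<^sup>2 + 1 / (2 * k) * indicator A \<sigma>))"
      by (intro Bochner_Integration.integrable_add integrable_mult_right Z_int Z2_int) (simp add: emeasure_eq_measure)
    show "AE \<sigma> in ?M. Z \<sigma> * S \<sigma> \<le> x * Z \<sigma> + (k / 2 * (Z \<sigma>)\<^sup>2 + 1 / (2 * k) * indicator A \<sigma>)"
      using AE_spin_space[of n] AE_space
    proof eventually_elim
      case (elim \<sigma>)
      have "0 \<le> Z \<sigma>" unfolding Z_def z_def
        by (rule prod_nonneg) (use elim(1) \<theta> in \<open>fastforce simp: abs_le_iff\<close>)
      have "S \<sigma> \<le> (\<Sum>u\<in>D. \<bar>w u\<bar>)" unfolding S_def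
        by (rule sum_mono) (use elim(1) BD in fastforce)
      then have "S \<sigma> \<le> 1" using w by simp
      have amgm: "Z \<sigma> \<le> k / 2 * (Z \<sigma>)\<^sup>2 + 1 / (2 * k)"
      proof -
        have "0 \<le> (k * Z \<sigma> - 1)\<^sup>2 / (2 * k)" using k by simp
        also have "\<dots> = k / 2 * (Z \<sigma>)\<^sup>2 + 1 / (2 * k) - Z \<sigma>"
          using k by (simp add: power2_eq_square field_simps)
        finally show ?thesis by simp
      qed
      show ?case
      proof (cases "\<sigma> \<in> A")
        case True
        have "Z \<sigma> * S \<sigma> \<le> Z \<sigma>" using \<open>0 \<le> Z \<sigma>\<close> \<open>S \<sigma> \<le> 1\<close> by (simp add: mult_left_le)
        moreover have "0 \<le> x * Z \<sigma>" using x \<open>0 \<le> Z \<sigma>\<close> by simp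
        ultimately show ?thesis using amgm True by simp
      next
        case False
        then have "S \<sigma> \<le> x" using elim by (auto simp: A_def)
        then have "Z \<sigma> * S \<sigma> \<le> x * Z \<sigma>" using \<open>0 \<le> Z \<sigma>\<close> by (simp add: mult_right_mono mult.commute)
        moreover have "0 \<le> k / 2 * (Z \<sigma>)\<^sup>2" using k by simp
        ultimately show ?thesis using False by simp
      qed
    qed
  qed (rule ZS_int)
  also have "\<dots> = x * 1 + (k / 2 * m + 1 / (2 * k) * measure ?M A)"
    using Z_int Z2_int by (simp add: Z_mean Z2_mean emeasure_eq_measure)
  finally have "q \<le> q / 2 + m / (2 * q) * measure ?M A"
    using mean q m by (simp add: ZS_mean k_def)
  then have "q * q \<le> m * measure ?M A"
    using q by (simp add: field_simps)
  then have "q\<^sup>2 / m \<le> measure ?M A"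
    using m by (simp add: power2_eq_square field_simps)
  then show ?thesis by (simp only: A_def S_def m_def)
qed

section \<open>Independence of the spins in disjoint blocks\<close>

lemma spin_coordinates_indep:
  "0 < n \<Longrightarrow> prob_space.indep_vars (spin_space n) (\<lambda>_. measure_pmf spin_pmf) (\<lambda>u \<sigma>. \<sigma> u) {..<n}"
proof -
  assume "0 < n"
  interpret prob_space "spin_space n" by (rule prob_space_spin_space)
  have rv: "(\<lambda>\<sigma>. \<sigma> u) \<in> measurable (spin_space n) (measure_pmf spin_pmf)" if "u \<in> {..<n}" for u
    unfolding spin_space_def using that by (rule measurable_component_singleton)
  have "distr (spin_space n) (PiM {..<n} (\<lambda>_. measure_pmf spin_pmf)) (\<lambda>\<sigma>. \<lambda>u\<in>{..<n}. \<sigma> u)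
      = distr (spin_space n) (spin_space n) (\<lambda>\<sigma>. \<sigma>)"
    by (rule distr_cong) (auto simp: spin_space_def space_PiM PiE_iff extensional_restrict)
  also have "\<dots> = spin_space n" by simp
  also have "\<dots> = PiM {..<n} (\<lambda>u. distr (spin_space n) (measure_pmf spin_pmf) (\<lambda>\<sigma>. \<sigma> u))"
    unfolding spin_space_def
    by (intro PiM_cong refl distr_PiM_component[symmetric] measure_pmf.prob_space_axioms)
  finally show ?thesis
    using \<open>0 < n\<close> rv by (subst indep_vars_iff_distr_eq_PiM') auto
qed

text \<open>Sums over disjoint sets of spins are independent, and each stays below \<open>x\<close>
  with probability at most \<open>1 - p \<le> exp (- p)\<close>.\<close>

lemma spin_blocks_all_below:
  fixes w :: "nat \<Rightarrow> nat \<Rightarrow> real"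
  assumes n: "0 < n" and L: "finite L" and D: "\<And>j. j \<in> L \<Longrightarrow> D j \<subseteq> {..<n}" "disjoint_family_on D L"
    and p: "\<And>j. j \<in> L \<Longrightarrow> p \<le> measure (spin_space n) {\<sigma> \<in> space (spin_space n). x \<le> (\<Sum>u\<in>D j. w j u * \<sigma> u)}"
  shows "measure (spin_space n) {\<sigma> \<in> space (spin_space n). \<forall>j\<in>L. (\<Sum>u\<in>D j. w j u * \<sigma> u) < x}
    \<le> exp (- p * card L)"
proof (cases "L = {}")
  case True
  interpret prob_space "spin_space n" by (rule prob_space_spin_space)
  show ?thesis using True by simp
next
  case False
  interpret prob_space "spin_space n" by (rule prob_space_spin_space)
  let ?M = "spin_space n"
  let ?S = "\<lambda>j \<sigma>. \<Sum>u\<in>D j. w j u * \<sigma> u"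
  let ?g = "\<lambda>j y. \<Sum>u\<in>D j. w j u * y u"
  have g: "?g j \<in> borel_measurable (PiM (D j) (\<lambda>_. measure_pmf spin_pmf))" for j
  proof -
    have "(\<lambda>y. id (y u)) \<in> borel_measurable (PiM (D j) (\<lambda>_. measure_pmf spin_pmf))" if "u \<in> D j" for u
      by (rule measurable_compose[OF measurable_component_singleton[OF that]]) simp
    then show ?thesis by (intro borel_measurable_sum borel_measurable_times) auto
  qed
  have "indep_vars (\<lambda>j. PiM (D j) (\<lambda>_. measure_pmf spin_pmf)) (\<lambda>j \<sigma>. restrict (\<lambda>u. \<sigma> u) (D j)) L"
    by (rule indep_vars_restrict[OF spin_coordinates_indep[OF n] D])
  then have "indep_vars (\<lambda>_. borel) (\<lambda>j \<sigma>. ?g j (restrict (\<lambda>u. \<sigma> u) (D j))) L"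
    by (rule indep_vars_compose2) (rule g)
  then have indep: "indep_vars (\<lambda>_. borel) ?S L"
    by simp
  have [measurable]: "?S j \<in> borel_measurable ?M" if "j \<in> L" for j
    by (rule spin_sum_measurable[OF D(1)[OF that]])
  have "{\<sigma> \<in> space ?M. \<forall>j\<in>L. ?S j \<sigma> < x} = (\<Inter>j\<in>L. ?S j -` {..<x} \<inter> space ?M)"
    using False by auto
  then have "prob {\<sigma> \<in> space ?M. \<forall>j\<in>L. ?S j \<sigma> < x} = (\<Prod>j\<in>L. prob (?S j -` {..<x} \<inter> space ?M))"
    using indep_varsD_finite[OF indep False L, of "\<lambda>_. {..<x}"] by simp
  also have "\<dots> \<le> (\<Prod>j\<in>L. exp (- p))"
  proof (rule prod_mono, intro conjI measure_nonneg)
    fix j assume j: "j \<in> L"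
    have ev: "{\<sigma> \<in> space ?M. x \<le> ?S j \<sigma>} \<in> events" using j by measurable
    have "?S j -` {..<x} \<inter> space ?M = space ?M - {\<sigma> \<in> space ?M. x \<le> ?S j \<sigma>}" by auto
    then have "prob (?S j -` {..<x} \<inter> space ?M) = 1 - prob {\<sigma> \<in> space ?M. x \<le> ?S j \<sigma>}"
      using prob_compl[OF ev] by simp
    also have "\<dots> \<le> 1 + (- p)" using p[OF j] by simp
    also have "\<dots> \<le> exp (- p)" by (rule exp_ge_add_one_self)
    finally show "prob (?S j -` {..<x} \<inter> space ?M) \<le> exp (- p)" .
  qed
  also have "\<dots> = exp (- p * card L)" by (simp add: exp_of_nat_mult[symmetric] mult.commute)
  finally show ?thesis .
qed

subsection \<open>Blocks\<close>

definition mass_outside :: "nat \<Rightarrow> nat list \<Rightarrow> nat \<Rightarrow> nat \<Rightarrow> real" where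
  "mass_outside n xs v r = (\<Sum>u | u < n \<and> real r \<le> \<bar>real u - real v\<bar>. weight n xs v u)"

definition near :: "nat \<Rightarrow> nat \<Rightarrow> nat \<Rightarrow> nat set" where
  "near n v r = {u. u < n \<and> \<bar>real u - real v\<bar> < real r}"

text \<open>Blocks of width \<open>2 * R\<close> lie side by side starting at vertex 0; the offset
  \<open>R\<close> keeps every centre at distance at least \<open>R\<close> from the seam on that
  side.\<close>

definition block_centre :: "nat \<Rightarrow> nat \<Rightarrow> nat" where
  "block_centre R j = 2 * R * j + R"

text \<open>Two scales: the mass \<open>3 / 4\<close> within \<open>r\<close> is what tilting the
  nearby spins can use, and the mass \<open>\<epsilon> / 8\<close> beyond \<open>R\<close> is the
  error made by ignoring the spins outside the block.\<close>

definition good_block :: "nat \<Rightarrow> real \<Rightarrow> nat \<Rightarrow> nat \<Rightarrow> nat list \<Rightarrow> nat \<Rightarrow> bool" where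
  "good_block n \<epsilon> r R xs j \<longleftrightarrow>
     mass_outside n xs (block_centre R j) r \<le> 1 / 4 \<and> mass_outside n xs (block_centre R j) R \<le> \<epsilon> / 8"

lemma sum_near_plus_outside:
  fixes h :: "nat \<Rightarrow> real"
  shows "(\<Sum>u\<in>near n v r. h u) + (\<Sum>u | u < n \<and> real r \<le> \<bar>real u - real v\<bar>. h u) = (\<Sum>u<n. h u)"
proof -
  have "{..<n} = near n v r \<union> {u. u < n \<and> real r \<le> \<bar>real u - real v\<bar>}"
    by (auto simp: near_def)
  moreover have "near n v r \<inter> {u. u < n \<and> real r \<le> \<bar>real u - real v\<bar>} = {}"
    by (auto simp: near_def)
  moreover have "finite (near n v r)" by (simp add: near_def)
  ultimately show ?thesis by (simp add: sum.union_disjoint)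
qed

lemma card_near_le:
  assumes "r \<le> v"
  shows "card (near n v r) \<le> 2 * r"
proof -
  have "near n v r \<subseteq> {v - r..<v + r}"
    using assms by (auto simp: near_def abs_less_iff)
  then have "card (near n v r) \<le> card {v - r..<v + r}" by (intro card_mono) auto
  then show ?thesis using assms by simp
qed

lemma disjoint_near_blocks: "disjoint_family_on (\<lambda>j. near n (block_centre R j) R) L"
  unfolding disjoint_family_on_def
proof (intro ballI impI)
  fix i j :: nat assume "i \<noteq> j"
  have *: "near n (block_centre R i) R \<inter> near n (block_centre R j) R = {}" if "i < j" for i j
  proof -
    have "2 * R * i + 2 * R \<le> 2 * R * j"
      using that mult_le_mono2[of "Suc i" j "2 * R"] by simp
    then have "real (block_centre R i) + 2 * real R \<le> real (block_centre R j)"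
      unfolding block_centre_def by linarith
    then show ?thesis by (auto simp: near_def abs_less_iff)
  qed
  show "near n (block_centre R i) R \<inter> near n (block_centre R j) R = {}"
    using *[of i j] *[of j i] \<open>i \<noteq> j\<close> by (cases "i < j") (auto simp: Int_commute)
qed

lemma block_centre_bounds:
  assumes "j < J" "2 * R * J < n"
  shows "R \<le> block_centre R j" "block_centre R j + R < n"
proof -
  have "2 * R * Suc j \<le> 2 * R * J" using assms by (intro mult_le_mono2) auto
  then show "R \<le> block_centre R j" "block_centre R j + R < n"
    using assms by (auto simp: block_centre_def)
qed

text \<open>Two applications of Markov's inequality. The second moment bound makes each block bad
  for at most a quarter of the sequences, so the mean number of bad blocks is at most
  \<open>J / 4\<close>; hence at most half of the sequences have more than \<open>J / 2\<close> bad
  blocks.\<close>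

lemma card_good_lists:
  fixes \<epsilon> :: real
  assumes n: "2 \<le> n" and \<epsilon>: "0 < \<epsilon>" and r: "0 < r" "r \<le> R" and J: "0 < J" "2 * R * J < n"
    and spread: "32 * (N / n) \<le> (real r)\<^sup>2" "64 * (N / n) \<le> \<epsilon> * (real R)\<^sup>2"
  shows "real n ^ N / 2
    \<le> card {xs. (set xs \<subseteq> {..<n} \<and> length xs = N) \<and> J \<le> 2 * card {j. j < J \<and> good_block n \<epsilon> r R xs j}}"
    (is "_ \<le> real (card ?G)")
proof -
  let ?L = "{xs. set xs \<subseteq> {..<n} \<and> length xs = N}"
  let ?bad = "\<lambda>xs. {j. j < J \<and> \<not> good_block n \<epsilon> r R xs j}"
  \<comment> \<open>A block that fails at scale \<open>r\<close> has capped second moment at least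
    \<open>r\<^sup>2 / 4\<close>, one that fails at scale \<open>R\<close> at least
    \<open>\<epsilon> * R\<^sup>2 / 8\<close>. \<open>K\<close> is the sum of the reciprocals, so
    \<open>K\<close> times the moment is at least 1 in both cases.\<close>
  define K where "K = 4 / (real r)\<^sup>2 + 8 / (\<epsilon> * (real R)\<^sup>2)"
  have R: "0 < R" using r by simp
  have K: "0 \<le> K" using \<epsilon> by (simp add: K_def)
  have "K * (N / n) \<le> 1 / 4"
  proof -
    have "4 / (real r)\<^sup>2 * (N / n) \<le> 1 / 8" "8 / (\<epsilon> * (real R)\<^sup>2) * (N / n) \<le> 1 / 8"
      using spread r R \<epsilon> n by (simp_all add: divide_le_eq mult.commute)
    then show ?thesis unfolding K_def distrib_right by linarith
  qed
  have L: "finite ?L" "card ?L = n ^ N"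
    using finite_lists_length_eq[of "{..<n}" N] card_lists_length_eq[of "{..<n}" N] by auto
  have bad: "1 \<le> K * evolve n xs (capsq R (block_centre R j)) (block_centre R j)"
    if xs: "xs \<in> ?L" and j: "j \<in> ?bad xs" for xs j
  proof -
    let ?v = "block_centre R j"
    let ?e = "evolve n xs (capsq R ?v) ?v"
    have v: "?v < n" using block_centre_bounds[of j J R n] j J by auto
    have o: "(real \<rho>)\<^sup>2 * mass_outside n xs ?v \<rho> \<le> ?e" if "\<rho> \<le> R" for \<rho>
      unfolding mass_outside_def using xs v that by (intro outside_weight_le) auto
    have e0: "0 \<le> ?e"
      using evolve_eq_sum_weight[of xs n ?v] xs v
      by (auto intro!: sum_nonneg mult_nonneg_nonneg weight_nonneg simp: capsq_def)
    from j consider "1 / 4 < mass_outside n xs ?v r" | "\<epsilon> / 8 < mass_outside n xs ?v R"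
      by (auto simp: good_block_def)
    then show ?thesis
    proof cases
      case 1
      have "(real r)\<^sup>2 * (1 / 4) \<le> (real r)\<^sup>2 * mass_outside n xs ?v r"
        using 1 by (intro mult_left_mono) auto
      then have "(real r)\<^sup>2 * (1 / 4) \<le> ?e" using o[OF r(2)] by linarith
      then have "1 \<le> 4 / (real r)\<^sup>2 * ?e" using r by (simp add: field_simps)
      moreover have "0 \<le> 8 / (\<epsilon> * (real R)\<^sup>2) * ?e" using e0 \<epsilon> by simp
      ultimately show ?thesis unfolding K_def distrib_right by linarith
    next
      case 2
      have "(real R)\<^sup>2 * (\<epsilon> / 8) \<le> (real R)\<^sup>2 * mass_outside n xs ?v R"
        using 2 by (intro mult_left_mono) auto
      then have "(real R)\<^sup>2 * (\<epsilon> / 8) \<le> ?e" using o[of R] by linarith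
      then have "1 \<le> 8 / (\<epsilon> * (real R)\<^sup>2) * ?e" using R \<epsilon> by (simp add: field_simps)
      moreover have "0 \<le> 4 / (real r)\<^sup>2 * ?e" using e0 by simp
      ultimately show ?thesis unfolding K_def distrib_right by linarith
    qed
  qed
  have "(\<Sum>xs\<in>?L. real (card (?bad xs)))
      \<le> (\<Sum>xs\<in>?L. \<Sum>j<J. K * evolve n xs (capsq R (block_centre R j)) (block_centre R j))"
  proof (rule sum_mono)
    fix xs assume xs: "xs \<in> ?L"
    have "real (card (?bad xs)) = (\<Sum>j\<in>?bad xs. 1)" by simp
    also have "\<dots> \<le> (\<Sum>j\<in>?bad xs. K * evolve n xs (capsq R (block_centre R j)) (block_centre R j))"
      by (intro sum_mono bad[OF xs])
    also have "\<dots> \<le> (\<Sum>j<J. K * evolve n xs (capsq R (block_centre R j)) (block_centre R j))"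
    proof (rule sum_mono2)
      fix j assume "j \<in> {..<J} - ?bad xs"
      then have v: "block_centre R j < n" using block_centre_bounds[of j J R n] J by auto
      show "0 \<le> K * evolve n xs (capsq R (block_centre R j)) (block_centre R j)"
        using evolve_eq_sum_weight[of xs n "block_centre R j"] xs v K
        by (auto intro!: sum_nonneg mult_nonneg_nonneg weight_nonneg simp: capsq_def)
    qed auto
    finally show "real (card (?bad xs)) \<le> \<dots>" .
  qed
  also have "\<dots> = (\<Sum>j<J. K * (\<Sum>xs\<in>?L. evolve n xs (capsq R (block_centre R j)) (block_centre R j)))"
    by (subst sum.swap) (simp add: sum_distrib_left)
  also have "\<dots> \<le> (\<Sum>j<J. K * (n ^ N * (N / n)))"
  proof (intro sum_mono mult_left_mono K)
    fix j assume "j \<in> {..<J}"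
    then have v: "R \<le> block_centre R j" "block_centre R j + R < n"
      using block_centre_bounds[of j J R n] J by auto
    have "(\<Sum>xs\<in>?L. evolve n xs (capsq R (block_centre R j)) (block_centre R j))
      \<le> real n ^ N * (capsq R (block_centre R j) (block_centre R j) + N / n)"
      using n v by (intro sum_evolve_le capsq_laplacian_le) auto
    then show "(\<Sum>xs\<in>?L. evolve n xs (capsq R (block_centre R j)) (block_centre R j)) \<le> n ^ N * (N / n)"
      by (simp add: capsq_def)
  qed
  also have "\<dots> = J * n ^ N * (K * (N / n))" by simp
  also have "\<dots> \<le> J * n ^ N * (1 / 4)"
    using \<open>K * (N / n) \<le> 1 / 4\<close> by (intro mult_left_mono) auto
  finally have total: "(\<Sum>xs\<in>?L. real (card (?bad xs))) \<le> J * n ^ N / 4" by simp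
  have split: "card {j. j < J \<and> good_block n \<epsilon> r R xs j} + card (?bad xs) = J" for xs
  proof -
    have "card ({j. j < J \<and> good_block n \<epsilon> r R xs j} \<union> ?bad xs)
      = card {j. j < J \<and> good_block n \<epsilon> r R xs j} + card (?bad xs)"
      by (rule card_Un_disjoint) auto
    moreover have "{j. j < J \<and> good_block n \<epsilon> r R xs j} \<union> ?bad xs = {..<J}" by auto
    ultimately show ?thesis by simp
  qed
  have "real (card (?L - ?G)) * (J / 2) = (\<Sum>xs\<in>?L - ?G. J / 2)" by simp
  also have "\<dots> \<le> (\<Sum>xs\<in>?L - ?G. real (card (?bad xs)))"
  proof (rule sum_mono)
    fix xs assume "xs \<in> ?L - ?G"
    then have "2 * card {j. j < J \<and> good_block n \<epsilon> r R xs j} < J" by auto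
    then have "J \<le> 2 * card (?bad xs)" using split[of xs] by linarith
    then show "J / 2 \<le> real (card (?bad xs))" by simp
  qed
  also have "\<dots> \<le> (\<Sum>xs\<in>?L. real (card (?bad xs)))"
    using L by (intro sum_mono2) auto
  also note total
  finally have "real (card (?L - ?G)) \<le> n ^ N / 2" using J by (simp add: field_simps)
  moreover have "card (?L - ?G) = card ?L - card ?G"
    using L by (intro card_Diff_subset finite_subset[of ?G ?L]) auto
  moreover have "card ?G \<le> card ?L" using L by (intro card_mono) auto
  ultimately show ?thesis using L(2) by (simp add: of_nat_diff)
qed

section \<open>Block centres with opinions of both signs\<close>

text \<open>For each sign, all good blocks fail to reach \<open>\<epsilon>\<close> with probability
  at most \<open>1 / 4\<close>. Otherwise some block sum is at least \<open>\<epsilon>\<close> and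
  another at most \<open>- \<epsilon>\<close>. Replacing block sums by opinions costs
  \<open>\<epsilon> / 8\<close> each, and
  \<open>2 * \<epsilon> - \<epsilon> / 4 > \<epsilon>\<close>.\<close>

lemma spin_event:
  fixes \<epsilon> :: real
  assumes n: "2 \<le> n" and \<epsilon>: "0 < \<epsilon>" "\<epsilon> < 1 / 3" and r: "0 < r" "r \<le> R" and J: "0 < J" "2 * R * J < n"
    and xs: "set xs \<subseteq> {..<n}"
    and good: "J \<le> 2 * card {j. j < J \<and> good_block n \<epsilon> r R xs j}"
    and p: "exp (- ((\<epsilon> / 2)\<^sup>2 / (1 + (2 * \<epsilon>)\<^sup>2) ^ (2 * r)) * (J / 2)) \<le> 1 / 4"
  obtains A where "A \<in> sets (spin_space n)" "1 / 2 \<le> measure (spin_space n) A"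
    "\<And>\<sigma>. \<sigma> \<in> A \<Longrightarrow> \<epsilon> < osc n (evolve n xs \<sigma>)"
proof -
  interpret prob_space "spin_space n" by (rule prob_space_spin_space)
  let ?M = "spin_space n"
  define L where "L = {j. j < J \<and> good_block n \<epsilon> r R xs j}"
  define v where "v = block_centre R"
  define D where "D j = near n (v j) R" for j
  define S where "S s j \<sigma> = (\<Sum>u\<in>D j. s * weight n xs (v j) u * \<sigma> u)" for s :: real and j and \<sigma> :: "nat \<Rightarrow> real"
  define p' where "p' = (\<epsilon> / 2)\<^sup>2 / (1 + (2 * \<epsilon>)\<^sup>2) ^ (2 * r)"
  have L: "finite L" "real J / 2 \<le> card L" using good by (auto simp: L_def)
  have D: "D j \<subseteq> {..<n}" for j by (auto simp: D_def near_def)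
  have S_meas [measurable]: "S s j \<in> borel_measurable ?M" for s j
    unfolding S_def by (rule spin_sum_measurable[OF D])
  have vL: "v j < n" "R \<le> v j" if "j \<in> L" for j
    using that block_centre_bounds[of j J R n] J by (auto simp: L_def v_def)
  have mass: "(\<Sum>u\<in>near n (v j) \<rho>. weight n xs (v j) u) = 1 - mass_outside n xs (v j) \<rho>" if "j \<in> L" for j \<rho>
    using sum_near_plus_outside[of "weight n xs (v j)" n "v j" \<rho>] sum_weight[OF xs vL(1)[OF that]]
    by (simp add: mass_outside_def)
  have outside_nonneg: "0 \<le> mass_outside n xs w \<rho>" for w \<rho>
    unfolding mass_outside_def by (intro sum_nonneg weight_nonneg)
  have below: "prob {\<sigma> \<in> space ?M. \<forall>j\<in>L. S s j \<sigma> < \<epsilon>} \<le> 1 / 4" if s: "s = 1 \<or> s = -1" for s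
  proof -
    have s2: "s * s = 1" "\<bar>s\<bar> = 1" using s by auto
    have lower: "p' \<le> prob {\<sigma> \<in> space ?M. \<epsilon> \<le> S s j \<sigma>}" if j: "j \<in> L" for j
    proof -
      let ?B = "near n (v j) r"
      have "p' \<le> (\<epsilon> / 2)\<^sup>2 / (1 + (2 * \<epsilon> * s)\<^sup>2) ^ card ?B"
      proof -
        have eq: "(2 * \<epsilon> * s)\<^sup>2 = (2 * \<epsilon>)\<^sup>2" using s by auto
        have "card ?B \<le> 2 * r" using vL(2)[OF j] r by (intro card_near_le) auto
        then have "(1 + (2 * \<epsilon>)\<^sup>2) ^ card ?B \<le> (1 + (2 * \<epsilon>)\<^sup>2) ^ (2 * r)"
          by (intro power_increasing) auto
        moreover have "0 < (1 + (2 * \<epsilon>)\<^sup>2) ^ card ?B" by (intro zero_less_power add_pos_nonneg) auto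
        ultimately show ?thesis unfolding eq p'_def by (intro divide_left_mono mult_pos_pos) auto
      qed
      \<comment> \<open>The tilt is \<open>\<theta> = 2 * \<epsilon> * s\<close>, at most 1 in
        modulus as \<open>\<epsilon> < 1 / 3\<close>. On mass at least \<open>3 / 4\<close> it gives
        mean at least \<open>3 / 2 * \<epsilon>\<close>, which exceeds the threshold
        \<open>x = \<epsilon>\<close> by \<open>q = \<epsilon> / 2\<close>.\<close>
      also have "\<dots> \<le> prob {\<sigma> \<in> space ?M. \<epsilon> \<le> (\<Sum>u\<in>D j. s * weight n xs (v j) u * \<sigma> u)}"
      proof (rule spin_tilt_lower_bound)
        show "?B \<subseteq> D j" using r by (auto simp: D_def near_def)
        show "(\<Sum>u\<in>D j. \<bar>s * weight n xs (v j) u\<bar>) \<le> 1"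
          using mass[OF j, of R] outside_nonneg[of "v j" R] s2 weight_nonneg
          by (simp add: abs_mult D_def)
        have "mass_outside n xs (v j) r \<le> 1 / 4"
          using j by (simp add: L_def good_block_def v_def)
        then have "2 * \<epsilon> * (3 / 4) \<le> 2 * \<epsilon> * (\<Sum>u\<in>?B. weight n xs (v j) u)"
          using \<epsilon> mass[OF j, of r] by (intro mult_left_mono) auto
        also have "\<dots> = 2 * \<epsilon> * s * (\<Sum>u\<in>?B. s * weight n xs (v j) u)"
          using s by (auto simp: sum_negf)
        finally show "\<epsilon> / 2 + \<epsilon> \<le> 2 * \<epsilon> * s * (\<Sum>u\<in>?B. s * weight n xs (v j) u)" by simp
        show "\<bar>2 * \<epsilon> * s\<bar> \<le> 1" using \<epsilon> s by auto
      qed (use \<epsilon> D in auto)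
      finally show ?thesis by (simp add: S_def)
    qed
    have "prob {\<sigma> \<in> space ?M. \<forall>j\<in>L. S s j \<sigma> < \<epsilon>} \<le> exp (- p' * card L)"
      unfolding S_def using n L(1) lower D disjoint_near_blocks
      by (intro spin_blocks_all_below) (auto simp: S_def D_def v_def)
    also have "\<dots> \<le> exp (- p' * (J / 2))"
      using mult_left_mono[OF L(2), of p'] by (simp add: p'_def add_nonneg_nonneg)
    finally show ?thesis using p by (simp add: p'_def)
  qed
  define A0 where "A0 = {\<sigma> \<in> space ?M. (\<forall>j\<in>L. S 1 j \<sigma> < \<epsilon>) \<or> (\<forall>j\<in>L. S (-1) j \<sigma> < \<epsilon>)}"
  \<comment> \<open>Almost every spin configuration lies in \<open>A1\<close>; membership bounds the
    contribution from outside a block by the weight there.\<close>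
  define A1 where "A1 = {\<sigma> \<in> space ?M. \<forall>u\<in>{..<n}. \<bar>\<sigma> u\<bar> \<le> 1}"
  have [measurable]: "{\<sigma> \<in> space ?M. \<forall>j\<in>L. S s j \<sigma> < \<epsilon>} \<in> events" for s
    using L(1) by measurable
  have A0: "A0 \<in> events" "prob A0 \<le> 1 / 2"
  proof -
    have eq: "A0 = {\<sigma> \<in> space ?M. \<forall>j\<in>L. S 1 j \<sigma> < \<epsilon>} \<union> {\<sigma> \<in> space ?M. \<forall>j\<in>L. S (-1) j \<sigma> < \<epsilon>}"
      by (auto simp: A0_def)
    show "A0 \<in> events" unfolding eq by measurable
    have "prob A0 \<le> prob {\<sigma> \<in> space ?M. \<forall>j\<in>L. S 1 j \<sigma> < \<epsilon>} + prob {\<sigma> \<in> space ?M. \<forall>j\<in>L. S (-1) j \<sigma> < \<epsilon>}"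
      unfolding eq by (rule measure_Un_le) measurable
    then show "prob A0 \<le> 1 / 2" using below[of 1] below[of "-1"] by simp
  qed
  have A1: "A1 \<in> events"
    unfolding A1_def using spin_component_measurable by measurable
  have "prob (space ?M - A0) = prob ((space ?M - A0) \<inter> A1)"
  proof (rule finite_measure_eq_AE)
    show "AE \<sigma> in ?M. \<sigma> \<in> space ?M - A0 \<longleftrightarrow> \<sigma> \<in> (space ?M - A0) \<inter> A1"
      using AE_spin_space[of n] by (rule eventually_mono) (force simp: A1_def)
  qed (use A0 A1 in auto)
  then have half: "1 / 2 \<le> prob ((space ?M - A0) \<inter> A1)"
    using prob_compl[OF A0(1)] A0(2) by simp
  have large: "\<epsilon> < osc n (evolve n xs \<sigma>)" if \<sigma>: "\<sigma> \<in> (space ?M - A0) \<inter> A1" for \<sigma>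
  proof -
    have le1: "\<bar>\<sigma> u\<bar> \<le> 1" if "u < n" for u using \<sigma> that by (auto simp: A1_def)
    obtain i j where i: "i \<in> L" "\<epsilon> \<le> S 1 i \<sigma>" and j: "j \<in> L" "\<epsilon> \<le> S (-1) j \<sigma>"
      using \<sigma> by (auto simp: A0_def not_less)
    have close: "\<bar>evolve n xs \<sigma> (v k) - S 1 k \<sigma>\<bar> \<le> \<epsilon> / 8" if k: "k \<in> L" for k
    proof -
      let ?O = "{u. u < n \<and> real R \<le> \<bar>real u - real (v k)\<bar>}"
      have "evolve n xs \<sigma> (v k) - S 1 k \<sigma> = (\<Sum>u\<in>?O. weight n xs (v k) u * \<sigma> u)"
        using sum_near_plus_outside[of "\<lambda>u. weight n xs (v k) u * \<sigma> u" n "v k" R]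
          evolve_eq_sum_weight[OF xs vL(1)[OF k]] by (simp add: S_def D_def)
      also have "\<bar>\<dots>\<bar> \<le> (\<Sum>u\<in>?O. \<bar>weight n xs (v k) u * \<sigma> u\<bar>)" by (rule sum_abs)
      also have "\<dots> \<le> (\<Sum>u\<in>?O. weight n xs (v k) u)"
        by (rule sum_mono) (use le1 weight_nonneg in \<open>auto simp: abs_mult intro!: mult_left_le\<close>)
      also have "\<dots> \<le> \<epsilon> / 8"
        using k by (simp add: L_def good_block_def v_def mass_outside_def)
      finally show ?thesis .
    qed
    have "S (-1) j \<sigma> = - S 1 j \<sigma>" by (simp add: S_def sum_negf)
    then have "\<epsilon> < \<bar>evolve n xs \<sigma> (v i) - evolve n xs \<sigma> (v j)\<bar>"
      using close[OF i(1)] close[OF j(1)] i(2) j(2) \<epsilon>(1) by linarith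
    also have "\<dots> \<le> osc n (evolve n xs \<sigma>)"
      by (rule osc_ge) (use vL i j in auto)
    finally show ?thesis .
  qed
  have ev: "(space ?M - A0) \<inter> A1 \<in> events" using A0(1) A1 by simp
  show thesis by (rule that[OF ev half large])
qed

section \<open>From these events to the expected averaging time\<close>

text \<open>The condition on \<open>T\<close> makes the Chernoff error at most \<open>1 / 2\<close>.
  Positivity of all waiting times holds almost surely and is built into the event so that the
  deterministic description of the opinions applies on it.\<close>

lemma clock_event:
  assumes xs: "set xs \<subseteq> {..<n}" and n: "0 < n" and T: "exp (n * T) \<le> 2 ^ length xs / 2"
  defines "E \<equiv> {X \<in> space (clock_space n). (ring_order n xs X \<and> T < ring_duration n xs X) \<and> (\<forall>k<n. \<forall>j. 0 < X (k, j))}"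
  shows "E \<in> sets (clock_space n)" "(1 / n) ^ length xs / 2 \<le> measure (clock_space n) E"
proof -
  interpret prob_space "clock_space n" by (rule prob_space_clock_space)
  let ?C = "clock_space n"
  note [measurable] = ring_order_measurable[OF xs] ring_duration_measurable[OF xs]
  have *: "{X \<in> space ?C. ring_order n xs X \<and> T < ring_duration n xs X} \<in> events" by measurable
  have pos: "{X \<in> space ?C. \<forall>k\<in>{..<n}. \<forall>j. 0 < X (k, j)} \<in> events"
  proof -
    have "Measurable.pred ?C (\<lambda>X. 0 < X (k, j))" if "k \<in> {..<n}" for k j
      using clock_component_measurable[of k n j] that by simp
    then have "Measurable.pred ?C (\<lambda>X. \<forall>k\<in>{..<n}. \<forall>j. 0 < X (k, j))"
      by (intro pred_intros_finite pred_intros_countable) auto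
    then show ?thesis by (simp add: pred_def)
  qed
  have "E = {X \<in> space ?C. ring_order n xs X \<and> T < ring_duration n xs X}
      \<inter> {X \<in> space ?C. \<forall>k\<in>{..<n}. \<forall>j. 0 < X (k, j)}"
    by (auto simp: E_def)
  then show E: "E \<in> sets ?C" using * pos by simp
  have "exp (n * T) / 2 ^ length xs \<le> 1 / 2" using T by (simp add: divide_le_eq)
  then have "(1 / n) ^ length xs * (1 / 2) \<le> (1 / n) ^ length xs * (1 - exp (n * T) / 2 ^ length xs)"
    by (intro mult_left_mono) auto
  also have "\<dots> \<le> prob {X \<in> space ?C. ring_order n xs X \<and> T < ring_duration n xs X}"
    by (rule prob_ring_order_duration[OF xs n])
  also have "\<dots> = prob E"
    by (rule finite_measure_eq_AE[OF _ * E])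
       (use AE_clock_space_pos[of n] in \<open>auto simp: E_def elim!: eventually_mono\<close>)
  finally show "(1 / n) ^ length xs / 2 \<le> prob E" by simp
qed

lemma tau_ge:
  assumes "\<forall>k<n. \<forall>j. 0 < X (k, j)" "ring_order n xs X" "set xs \<subseteq> {..<n}"
    "T < ring_duration n xs X" "\<epsilon> < osc n (evolve n xs f)"
  shows "ennreal T \<le> tau n \<epsilon> f X"
  unfolding tau_def
proof (rule Inf_greatest, clarify)
  fix t :: real assume t: "0 \<le> t" "osc n (opinion n f X t) \<le> \<epsilon>"
  show "ennreal T \<le> ennreal t"
  proof (rule ennreal_leI, rule ccontr)
    assume "\<not> T \<le> t"
    then have "osc n (evolve n xs f) \<le> osc n (opinion n f X t)"
      using assms t by (intro osc_opinion_ge) auto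
    then show False using assms(5) t by linarith
  qed
qed

text \<open>For each good sequence a spin event of probability at least \<open>1 / 2\<close> is
  paired with an independent clock event of probability at least \<open>(1 / n) ^ N / 2\<close>. The
  products are disjoint because the ring order is unique, and there are at least
  \<open>n ^ N / 2\<close> of them, so \<open>tau\<close> is at least \<open>T\<close> with
  probability at least \<open>1 / 8\<close>.\<close>

lemma expected_tau_ge:
  fixes \<epsilon> T :: real and n N r R J :: nat
  assumes n: "2 \<le> n" and \<epsilon>: "0 < \<epsilon>" "\<epsilon> < 1 / 3" and r: "0 < r" "r \<le> R" and J: "0 < J" "2 * R * J < n"
    and spread: "32 * (N / n) \<le> (real r)\<^sup>2" "64 * (N / n) \<le> \<epsilon> * (real R)\<^sup>2"
    and p: "exp (- ((\<epsilon> / 2)\<^sup>2 / (1 + (2 * \<epsilon>)\<^sup>2) ^ (2 * r)) * (J / 2)) \<le> 1 / 4"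
    and T: "exp (n * T) \<le> 2 ^ N / 2" "0 \<le> T"
  shows "ennreal (T / 8) \<le> (\<integral>\<^sup>+ \<omega>. tau n \<epsilon> (fst \<omega>) (snd \<omega>) \<partial>edge_avg_space n)"
proof -
  interpret S: prob_space "spin_space n" by (rule prob_space_spin_space)
  interpret C: prob_space "clock_space n" by (rule prob_space_clock_space)
  have space: "edge_avg_space n = spin_space n \<Otimes>\<^sub>M clock_space n"
    by (simp add: edge_avg_space_def spin_space_def clock_space_def)
  define G where "G = {xs. (set xs \<subseteq> {..<n} \<and> length xs = N) \<and> J \<le> 2 * card {j. j < J \<and> good_block n \<epsilon> r R xs j}}"
  have G: "xs \<in> G \<Longrightarrow> set xs \<subseteq> {..<n}" "xs \<in> G \<Longrightarrow> length xs = N" for xs by (auto simp: G_def)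
  have finG: "finite G"
    by (rule finite_subset[OF _ finite_lists_length_eq[of "{..<n}" N]]) (auto simp: G_def)
  have cardG: "real n ^ N / 2 \<le> card G"
    unfolding G_def by (rule card_good_lists[OF n \<epsilon>(1) r J spread])
  have "\<forall>xs\<in>G. \<exists>A. A \<in> sets (spin_space n) \<and> 1 / 2 \<le> measure (spin_space n) A \<and>
      (\<forall>\<sigma>\<in>A. \<epsilon> < osc n (evolve n xs \<sigma>))"
  proof
    fix xs assume "xs \<in> G"
    then have "set xs \<subseteq> {..<n}" "J \<le> 2 * card {j. j < J \<and> good_block n \<epsilon> r R xs j}"
      by (auto simp: G_def)
    from spin_event[OF n \<epsilon> r J this p]
    show "\<exists>A. A \<in> sets (spin_space n) \<and> 1 / 2 \<le> measure (spin_space n) A \<and>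
      (\<forall>\<sigma>\<in>A. \<epsilon> < osc n (evolve n xs \<sigma>))" by metis
  qed
  then obtain A where A: "\<And>xs. xs \<in> G \<Longrightarrow> A xs \<in> sets (spin_space n)"
      "\<And>xs. xs \<in> G \<Longrightarrow> 1 / 2 \<le> measure (spin_space n) (A xs)"
      "\<And>xs \<sigma>. xs \<in> G \<Longrightarrow> \<sigma> \<in> A xs \<Longrightarrow> \<epsilon> < osc n (evolve n xs \<sigma>)"
    by metis
  define E where "E xs = {X \<in> space (clock_space n). (ring_order n xs X \<and> T < ring_duration n xs X)
      \<and> (\<forall>k<n. \<forall>j. 0 < X (k, j))}" for xs
  have E: "E xs \<in> sets (clock_space n)" "(1 / n) ^ N / 2 \<le> measure (clock_space n) (E xs)" if "xs \<in> G" for xs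
    using clock_event[of xs n T] G[OF that] n T(1) by (auto simp: E_def)
  define F where "F xs = A xs \<times> E xs" for xs
  have F: "F xs \<in> sets (edge_avg_space n)" if "xs \<in> G" for xs
    using A(1)[OF that] E(1)[OF that] by (simp add: F_def space)
  have disj: "disjoint_family_on F G"
    unfolding disjoint_family_on_def F_def E_def using ring_order_unique G by fastforce
  have F_ge: "ennreal ((1 / n) ^ N / 4) \<le> emeasure (edge_avg_space n) (F xs)" if "xs \<in> G" for xs
  proof -
    have "(1 / n) ^ N / 4 = 1 / 2 * ((1 / n) ^ N / 2)" by simp
    also have "\<dots> \<le> measure (spin_space n) (A xs) * measure (clock_space n) (E xs)"
      using A(2)[OF that] E(2)[OF that] by (intro mult_mono) auto
    finally have "ennreal ((1 / n) ^ N / 4) \<le> ennreal (measure (spin_space n) (A xs)) * ennreal (measure (clock_space n) (E xs))"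
      by (subst ennreal_mult[symmetric]) (auto intro: ennreal_leI)
    also have "\<dots> = emeasure (edge_avg_space n) (F xs)"
      unfolding F_def space using A(1)[OF that] E(1)[OF that]
      by (simp add: C.emeasure_pair_measure_Times S.emeasure_eq_measure C.emeasure_eq_measure)
    finally show ?thesis .
  qed
  have "1 / 8 \<le> card G * ((1 / n) ^ N / 4)"
  proof -
    have "1 / 8 = real n ^ N / 2 * ((1 / n) ^ N / 4)" using n by (simp add: power_divide)
    also have "\<dots> \<le> card G * ((1 / n) ^ N / 4)" using cardG by (intro mult_right_mono) auto
    finally show ?thesis .
  qed
  then have "ennreal (1 / 8) \<le> ennreal (\<Sum>xs\<in>G. (1 / n) ^ N / 4)"
    by (intro ennreal_leI) simp
  also have "\<dots> = (\<Sum>xs\<in>G. ennreal ((1 / n) ^ N / 4))"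
    by (rule sum_ennreal[symmetric]) simp
  also have "\<dots> \<le> (\<Sum>xs\<in>G. emeasure (edge_avg_space n) (F xs))"
    by (rule sum_mono) (rule F_ge)
  also have "\<dots> = emeasure (edge_avg_space n) (\<Union>xs\<in>G. F xs)"
    using F disj finG by (intro sum_emeasure) auto
  finally have "ennreal T * ennreal (1 / 8) \<le> ennreal T * emeasure (edge_avg_space n) (\<Union>xs\<in>G. F xs)"
    by (rule mult_left_mono) simp
  also have "\<dots> = (\<integral>\<^sup>+\<omega>. ennreal T * indicator (\<Union>xs\<in>G. F xs) \<omega> \<partial>edge_avg_space n)"
    using F finG by (intro nn_integral_cmult_indicator[symmetric] sets.finite_UN) auto
  also have "\<dots> \<le> (\<integral>\<^sup>+ \<omega>. tau n \<epsilon> (fst \<omega>) (snd \<omega>) \<partial>edge_avg_space n)"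
  proof (rule nn_integral_mono)
    fix \<omega>
    show "ennreal T * indicator (\<Union>xs\<in>G. F xs) \<omega> \<le> tau n \<epsilon> (fst \<omega>) (snd \<omega>)"
    proof (cases "\<omega> \<in> (\<Union>xs\<in>G. F xs)")
      case True
      then obtain xs where xs: "xs \<in> G" "fst \<omega> \<in> A xs" "snd \<omega> \<in> E xs" by (auto simp: F_def)
      have "ennreal T \<le> tau n \<epsilon> (fst \<omega>) (snd \<omega>)"
        using xs G(1)[OF xs(1)] A(3)[OF xs(1,2)] by (intro tau_ge[where xs = xs]) (auto simp: E_def)
      then show ?thesis using True by simp
    qed simp
  qed
  finally show ?thesis using T(2) by (simp add: ennreal_mult'[symmetric])
qed

section \<open>Choice of the parameters\<close>

text \<open>For fixed \<open>\<epsilon>\<close> the logarithm tends to infinity but loses against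
  every positive power of \<open>n\<close>; the last product still grows like
  \<open>n powr (1/4)\<close>.\<close>

lemma parameters_eventually:
  fixes \<epsilon> :: real
  assumes "0 < \<epsilon>"
  shows "\<forall>\<^sub>F n in sequentially. 2 \<le> n \<and> \<epsilon>\<^sup>2 \<le> ln (real n) / 448 \<and>
    320 * (ln (real n) / (448 * \<epsilon>\<^sup>2))\<^sup>2 \<le> \<epsilon> * (sqrt (real n) / 2 - 1)\<^sup>2 \<and>
    14 * (ln (real n) / (448 * \<epsilon>\<^sup>2)) \<le> sqrt (real n) / 2 - 1 \<and>
    4 \<le> \<epsilon>\<^sup>2 / 4 * real n powr (-1/4) * (sqrt (real n) / 2 - 1)"
proof -
  have "\<forall>\<^sub>F n in sequentially. \<epsilon>\<^sup>2 \<le> ln (real n) / 448" by real_asymp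
  moreover have "\<forall>\<^sub>F n in sequentially.
      320 * (ln (real n) / (448 * \<epsilon>\<^sup>2))\<^sup>2 \<le> \<epsilon> * (sqrt (real n) / 2 - 1)\<^sup>2"
    using assms by real_asymp
  moreover have "\<forall>\<^sub>F n in sequentially. 14 * (ln (real n) / (448 * \<epsilon>\<^sup>2)) \<le> sqrt (real n) / 2 - 1"
    using assms by real_asymp
  moreover have "\<forall>\<^sub>F n in sequentially. 4 \<le> \<epsilon>\<^sup>2 / 4 * real n powr (-1/4) * (sqrt (real n) / 2 - 1)"
    using assms by real_asymp
  ultimately show ?thesis using eventually_ge_at_top[of "2::nat"] by eventually_elim auto
qed

lemma expected_tau_ge_log_squared:
  fixes \<epsilon> :: real
  assumes \<epsilon>: "0 < \<epsilon>" "\<epsilon> < 1 / 3" and n: "2 \<le> n"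
    and c1: "\<epsilon>\<^sup>2 \<le> ln (real n) / 448"
    and c2: "320 * (ln (real n) / (448 * \<epsilon>\<^sup>2))\<^sup>2 \<le> \<epsilon> * (sqrt (real n) / 2 - 1)\<^sup>2"
    and c3: "14 * (ln (real n) / (448 * \<epsilon>\<^sup>2)) \<le> sqrt (real n) / 2 - 1"
    and c4: "4 \<le> \<epsilon>\<^sup>2 / 4 * real n powr (-1/4) * (sqrt (real n) / 2 - 1)"
  shows "ennreal ((ln (real n) / (448 * \<epsilon>\<^sup>2))\<^sup>2 / 8)
    \<le> (\<integral>\<^sup>+ \<omega>. tau n \<epsilon> (fst \<omega>) (snd \<omega>) \<partial>edge_avg_space n)"
proof -
  \<comment> \<open>The time is \<open>T = a\<^sup>2\<close>, so \<open>a\<close> is the diffusive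
    length scale. The spins are tilted within \<open>r\<close> of order \<open>a\<close>, about
    \<open>\<surd>n / 2\<close> blocks of half-width \<open>R\<close> about
    \<open>\<surd>n / 2\<close> fit into the cycle, and \<open>N\<close> is about
    \<open>4 * n * T\<close> rings. The constant 448 is \<open>4 * 8 * 14\<close>: it makes the
    tilting cost \<open>exp (8 * \<epsilon>\<^sup>2 * 14 * a)\<close> equal to
    \<open>n powr (1/4)\<close>.\<close>
  define a where "a = ln (real n) / (448 * \<epsilon>\<^sup>2)"
  define r where "r = nat \<lceil>13 * a\<rceil>"
  define R where "R = nat \<lfloor>sqrt (real n) / 2\<rfloor>"
  define N where "N = nat \<lceil>4 * real n * a\<^sup>2\<rceil>"
  have a: "1 \<le> a" using c1 \<epsilon> by (simp add: a_def field_simps)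
  have a2: "1 \<le> a\<^sup>2" using power_mono[OF a, of 2] by simp
  have r: "13 * a \<le> r" "r \<le> 14 * a"
    using a unfolding r_def by linarith+
  have R: "sqrt (real n) / 2 - 1 \<le> R" "R \<le> sqrt (real n) / 2"
    unfolding R_def using real_sqrt_ge_zero[of "real n"] by linarith+
  have big: "14 * a \<le> sqrt (real n) / 2 - 1" using c3 by (simp add: a_def)
  have "0 \<le> 4 * real n * a\<^sup>2" by simp
  then have N: "4 * real n * a\<^sup>2 \<le> N" "N \<le> 4 * real n * a\<^sup>2 + 1"
    unfolding N_def by linarith+
  have "real N \<le> 5 * a\<^sup>2 * n"
  proof -
    have "1 \<le> real n * a\<^sup>2" using n a2 mult_mono[of 1 "real n" 1 "a\<^sup>2"] by simp
    then show ?thesis using N(2) by (simp add: algebra_simps)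
  qed
  then have Nn: "N / n \<le> 5 * a\<^sup>2" using n by (simp add: divide_le_eq)
  show ?thesis
    unfolding a_def[symmetric]
  proof (rule expected_tau_ge[OF n \<epsilon>])
    show "0 < r" using r a by linarith
    show "r \<le> R" using r R big by linarith
    show "0 < R" using R big a by linarith
    have "real (2 * R * R) \<le> 2 * (sqrt (real n) / 2 * (sqrt (real n) / 2))"
      using R(2) mult_mono[OF R(2) R(2)] by simp
    also have "\<dots> < real n" using n by simp
    finally show "2 * R * R < n" by (simp only: of_nat_less_iff)
    \<comment> \<open>The factor 13 is chosen since \<open>13\<^sup>2 = 169\<close> exceeds
      \<open>32 * 5\<close>, where \<open>5 * a\<^sup>2\<close> bounds \<open>N / n\<close>; in the
      same way 320 in \<open>c2\<close> is \<open>64 * 5\<close>.\<close>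
    have "(13 * a)\<^sup>2 \<le> (real r)\<^sup>2" using r a by (intro power_mono) auto
    then have "169 * a\<^sup>2 \<le> (real r)\<^sup>2" by (simp add: power_mult_distrib)
    then show "32 * (N / n) \<le> (real r)\<^sup>2" using Nn zero_le_power2[of a] by linarith
    have "(sqrt (real n) / 2 - 1)\<^sup>2 \<le> (real R)\<^sup>2" using R(1) big a by (intro power_mono) auto
    then have "\<epsilon> * (sqrt (real n) / 2 - 1)\<^sup>2 \<le> \<epsilon> * (real R)\<^sup>2"
      using \<epsilon> by (intro mult_left_mono) auto
    then show "64 * (N / n) \<le> \<epsilon> * (real R)\<^sup>2"
      using c2[folded a_def] Nn by linarith
    show "0 \<le> a\<^sup>2" by simp
    show "exp (real n * a\<^sup>2) \<le> 2 ^ N / 2"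
    proof -
      let ?y = "real n * a\<^sup>2"
      have y: "1 \<le> ?y" using n a2 mult_mono[of 1 "real n" 1 "a\<^sup>2"] by simp
      have "2 * exp ?y \<le> exp 1 * exp ?y"
        using exp_ge_add_one_self[of 1] by (intro mult_right_mono) auto
      also have "\<dots> = exp (1 + ?y)" by (simp add: exp_add)
      also have "\<dots> \<le> exp (real N * ln 2)"
      proof -
        \<comment> \<open>Since \<open>ln 2 \<ge> 1 / 2\<close>, the \<open>4 * ?y\<close> rings
          give at least \<open>2 * ?y\<close> in the exponent, which covers both \<open>?y\<close>
          and the factor 2.\<close>
        have "1 + ?y \<le> 4 * ?y * (1 / 2)" using y by simp
        also have "\<dots> \<le> real N * ln 2"
          using N(1) ln2_ge_two_thirds by (intro mult_mono) auto
        finally show ?thesis by simp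
      qed
      also have "\<dots> = 2 ^ N" by (simp add: exp_of_nat_mult)
      finally show ?thesis by simp
    qed
    show "exp (- ((\<epsilon> / 2)\<^sup>2 / (1 + (2 * \<epsilon>)\<^sup>2) ^ (2 * r)) * (R / 2)) \<le> 1 / 4"
    proof -
      let ?q = "(\<epsilon> / 2)\<^sup>2 / (1 + (2 * \<epsilon>)\<^sup>2) ^ (2 * r)"
      have pos: "0 < (1 + (2 * \<epsilon>)\<^sup>2) ^ (2 * r)" by (intro zero_less_power add_pos_nonneg) auto
      have "(1 + (2 * \<epsilon>)\<^sup>2) ^ (2 * r) \<le> exp ((2 * \<epsilon>)\<^sup>2) ^ (2 * r)"
        by (intro power_mono exp_ge_add_one_self) auto
      also have "\<dots> = exp (8 * \<epsilon>\<^sup>2 * r)"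
        by (simp add: exp_of_nat_mult[symmetric] power_mult_distrib mult_ac)
      also have "\<dots> \<le> exp (8 * \<epsilon>\<^sup>2 * (14 * a))"
        by (subst exp_le_cancel_iff, rule mult_left_mono[OF r(2)]) simp
      also have "8 * \<epsilon>\<^sup>2 * (14 * a) = 1 / 4 * ln n" using \<epsilon> by (simp add: a_def)
      also have "exp \<dots> = real n powr (1 / 4)" using n by (simp add: powr_def)
      finally have "\<epsilon>\<^sup>2 / 4 / (real n powr (1 / 4)) \<le> \<epsilon>\<^sup>2 / 4 / (1 + (2 * \<epsilon>)\<^sup>2) ^ (2 * r)"
        using pos n by (intro divide_left_mono mult_pos_pos) auto
      moreover have "real n powr (-1/4) = 1 / real n powr (1/4)"
        using powr_minus_divide[of "real n" "1/4"] by simp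
      moreover have "(\<epsilon> / 2)\<^sup>2 = \<epsilon>\<^sup>2 / 4" by (simp add: power_divide)
      ultimately have q: "\<epsilon>\<^sup>2 / 4 * real n powr (-1/4) \<le> ?q"
        by (simp only: times_divide_eq_right mult_1_right)
      \<comment> \<open>There are \<open>R\<close> blocks, at least half of them good;
        \<open>?q * R \<ge> 4\<close> brings the failure probability for one sign down to
        \<open>exp (-2) \<le> 1 / 4\<close>.\<close>
      have "4 \<le> \<epsilon>\<^sup>2 / 4 * real n powr (-1/4) * (sqrt (real n) / 2 - 1)" by (rule c4)
      also have "\<dots> \<le> ?q * R"
        using q R(1) big a pos by (intro mult_mono) auto
      finally have "4 \<le> ?q * R" .
      moreover have "- y * (z / 2) \<le> -2" if "4 \<le> y * z" for y z :: real using that by simp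
      ultimately have "- ?q * (R / 2) \<le> -2" by blast
      then have "exp (- ?q * (R / 2)) \<le> exp (-2)" by (simp only: exp_le_cancel_iff)
      also have "\<dots> \<le> 1 / 4"
      proof -
        have "2 * 2 \<le> exp 1 * exp (1::real)"
          using exp_ge_add_one_self[of 1] by (intro mult_mono) auto
        then have "4 \<le> exp (2::real)" by (simp add: exp_add[symmetric])
        then show ?thesis by (simp add: exp_minus field_simps)
      qed
      finally show ?thesis .
    qed
  qed
qed

theorem theorem5p1:
  shows "\<exists>c>0. \<forall>\<epsilon>::real. 0 < \<epsilon> \<and> \<epsilon> < 1/3 \<longrightarrow>
     (\<exists>n\<^sub>\<epsilon>::nat. \<forall>n>n\<^sub>\<epsilon>.
        ennreal (c * (ln (real n))^2 / \<epsilon>^4)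
          \<le> (\<integral>\<^sup>+ \<omega>. tau n \<epsilon> (fst \<omega>) (snd \<omega>) \<partial>edge_avg_space n))"
proof (intro exI[of _ "1 / (448\<^sup>2 * 8)"] conjI allI impI)
  fix \<epsilon> :: real assume \<epsilon>: "0 < \<epsilon> \<and> \<epsilon> < 1/3"
  obtain m where m: "\<And>n. m \<le> n \<Longrightarrow> 2 \<le> n \<and> \<epsilon>\<^sup>2 \<le> ln (real n) / 448 \<and>
    320 * (ln (real n) / (448 * \<epsilon>\<^sup>2))\<^sup>2 \<le> \<epsilon> * (sqrt (real n) / 2 - 1)\<^sup>2 \<and>
    14 * (ln (real n) / (448 * \<epsilon>\<^sup>2)) \<le> sqrt (real n) / 2 - 1 \<and>
    4 \<le> \<epsilon>\<^sup>2 / 4 * real n powr (-1/4) * (sqrt (real n) / 2 - 1)"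
    using parameters_eventually[of \<epsilon>] \<epsilon> unfolding eventually_sequentially by blast
  show "\<exists>n\<^sub>\<epsilon>::nat. \<forall>n>n\<^sub>\<epsilon>. ennreal (1 / (448\<^sup>2 * 8) * (ln (real n))^2 / \<epsilon>^4)
          \<le> (\<integral>\<^sup>+ \<omega>. tau n \<epsilon> (fst \<omega>) (snd \<omega>) \<partial>edge_avg_space n)"
  proof (intro exI[of _ m] allI impI)
    fix n assume "m < n"
    then have "ennreal ((ln (real n) / (448 * \<epsilon>\<^sup>2))\<^sup>2 / 8)
        \<le> (\<integral>\<^sup>+ \<omega>. tau n \<epsilon> (fst \<omega>) (snd \<omega>) \<partial>edge_avg_space n)"
      using m[of n] \<epsilon> by (intro expected_tau_ge_log_squared) auto
    \<comment> \<open>The universal constant combines the probability \<open>1 / 8\<close> with the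
      square of the 448 in the length scale.\<close>
    moreover have "(ln (real n) / (448 * \<epsilon>\<^sup>2))\<^sup>2 / 8 = 1 / (448\<^sup>2 * 8) * (ln (real n))^2 / \<epsilon>^4"
      by (simp add: power_divide power_mult_distrib flip: power_mult)
    ultimately show "ennreal (1 / (448\<^sup>2 * 8) * (ln (real n))^2 / \<epsilon>^4)
        \<le> (\<integral>\<^sup>+ \<omega>. tau n \<epsilon> (fst \<omega>) (snd \<omega>) \<partial>edge_avg_space n)"
      by simp
  qed
qed simp

end
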